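(* Let $X=(X_t)_{t\in\mathbb{R}_+}$ be a (càdlàg) Lévy process with characteristic triplet $(\gamma,\sigma,\nu)$, and let $\dot X$ be the associated Lévy white noise. Let $\Omega_{\dot X}=\{\omega\in\Omega:\dot X(\omega)\in\mathcal S'(\mathbb{R})\}$. Then: (i) If there exists $\eta>0$ such that $\mathbb{E}(|X_1|^\eta)<+\infty$, then $\mathbb{P}(\Omega_{\dot X})=1$. (ii) If $\mathbb{E}(|X_1|^\eta)=+\infty$ for all $\eta>0$, then $\mathbb{P}(\Omega_{\dot X})=0$.
   Context: $(\Omega,\mathcal F,\mathbb P)$ is a complete probability space. A Lévy process is a real-valued process $(X_t)_{t\in\mathbb{R}_+}$ with $X_0=0$ a.s., stationary independent increments, stochastically continuous; a càdlàg modification is always taken. Its characteristic triplet $(\gamma,\sigma,\nu)$ ($\gamma\in\mathbb{R}$, $\sigma\ge0$, $\nu$ a Lévy measure) is taken with respect to the truncation function $\mathbf 1_{|x|\le1}$. The Lévy white noise $\dot X$ is the derivative of $X$ in $\mathcal D'(\mathbb{R})$: for $\omega\in\Omega$ and $\varphi\in\mathcal D(\mathbb{R})$ (smooth, compactly supported), $\langle\dot X(\omega),\varphi\rangle=-\int_{\mathbb{R}_+}X_t(\omega)\varphi'(t)\,dt$. $\mathcal S(\mathbb{R})$ is the Schwartz space and $\mathcal S'(\mathbb{R})$ the space of tempered distributions; an element of $\mathcal D'(\mathbb{R})$ belongs to $\mathcal S'(\mathbb{R})$ if it extends to a continuous linear functional on $\mathcal S(\mathbb{R})$. *)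

theory Defs
  imports "HOL-Probability.Probability"
begin

section \<open>Levy processes\<close>

definition cadlag :: "(real \<Rightarrow> real) \<Rightarrow> bool" where
  "cadlag f \<longleftrightarrow>
     (\<forall>t\<ge>0. (f \<longlongrightarrow> f t) (at_right t)) \<and>
     (\<forall>t>0. \<exists>l. (f \<longlongrightarrow> l) (at_left t))"

text \<open>
  Time is indexed by the type of reals, but only the values of \<open>X\<close> at times \<open>t \<ge> 0\<close>
  are ever constrained or used. All paths are cadlag, not just almost all, so that the
  white noise below is meaningful for every outcome.
\<close>

definition levy_process :: "'a measure \<Rightarrow> (real \<Rightarrow> 'a \<Rightarrow> real) \<Rightarrow> bool" where
  "levy_process M X \<longleftrightarrow>
     (\<forall>t\<ge>0. X t \<in> borel_measurable M) \<and>
     (AE \<omega> in M. X 0 \<omega> = 0) \<and>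
     (\<forall>s\<ge>0. \<forall>h\<ge>0.
        distr M borel (\<lambda>\<omega>. X (s + h) \<omega> - X s \<omega>) = distr M borel (\<lambda>\<omega>. X h \<omega> - X 0 \<omega>)) \<and>
     (\<forall>(n::nat) t. 0 \<le> t 0 \<and> (\<forall>i<n. t i \<le> t (Suc i)) \<longrightarrow>
        prob_space.indep_vars M (\<lambda>_. borel) (\<lambda>i \<omega>. X (t (Suc i)) \<omega> - X (t i) \<omega>) {..<n}) \<and>
     (\<forall>t\<ge>0. \<forall>\<epsilon>>0.
        ((\<lambda>s. measure M {\<omega> \<in> space M. \<bar>X s \<omega> - X t \<omega>\<bar> > \<epsilon>}) \<longlongrightarrow> 0) (at t within {0..})) \<and>
     (\<forall>\<omega>\<in>space M. cadlag (\<lambda>t. X t \<omega>))"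

definition levy_measure :: "real measure \<Rightarrow> bool" where
  "levy_measure \<nu> \<longleftrightarrow>
     sets \<nu> = sets borel \<and> emeasure \<nu> {0} = 0 \<and>
     (\<integral>\<^sup>+x. ennreal (min 1 (x\<^sup>2)) \<partial>\<nu>) < \<infinity>"

text \<open>
  The Levy-Khintchine exponent for the truncation function \<open>indicator {-1..1}\<close>;
  \<open>\<sigma>\<close> is the standard deviation, not the variance, of the Gaussian part at time 1.
\<close>

definition levy_exponent :: "real \<Rightarrow> real \<Rightarrow> real measure \<Rightarrow> real \<Rightarrow> complex" where
  "levy_exponent \<gamma> \<sigma> \<nu> u =
     \<i> * complex_of_real (\<gamma> * u) - complex_of_real (\<sigma>\<^sup>2 * u\<^sup>2 / 2) +
     (CLINT x|\<nu>. iexp (u * x) - 1 - \<i> * complex_of_real (u * x * indicator {-1..1} x))"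

definition characteristic_triplet ::
    "'a measure \<Rightarrow> (real \<Rightarrow> 'a \<Rightarrow> real) \<Rightarrow> real \<Rightarrow> real \<Rightarrow> real measure \<Rightarrow> bool" where
  "characteristic_triplet M X \<gamma> \<sigma> \<nu> \<longleftrightarrow>
     \<sigma> \<ge> 0 \<and> levy_measure \<nu> \<and>
     (\<forall>t\<ge>0. \<forall>u. char (distr M borel (X t)) u = exp (complex_of_real t * levy_exponent \<gamma> \<sigma> \<nu> u))"

section \<open>Test functions, Schwartz space and tempered distributions\<close>

definition smooth :: "(real \<Rightarrow> real) \<Rightarrow> bool" where
  "smooth f \<longleftrightarrow> (\<forall>n x. (deriv ^^ n) f differentiable at x)"

definition test_functions :: "(real \<Rightarrow> real) set" where
  "test_functions = {\<phi>. smooth \<phi> \<and> compact (closure {x. \<phi> x \<noteq> 0})}"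

definition schwartz_space :: "(real \<Rightarrow> real) set" where
  "schwartz_space =
     {f. smooth f \<and> (\<forall>k m. bounded (range (\<lambda>x. x ^ k * (deriv ^^ m) f x)))}"

definition schwartz_seminorm :: "nat \<Rightarrow> nat \<Rightarrow> (real \<Rightarrow> real) \<Rightarrow> real" where
  "schwartz_seminorm k m f = (SUP x. \<bar>x ^ k * (deriv ^^ m) f x\<bar>)"

text \<open>The open seminorm balls form a subbasis of the usual Frechet topology.\<close>

definition schwartz_topology :: "(real \<Rightarrow> real) topology" where
  "schwartz_topology = topology_generated_by
     {{g \<in> schwartz_space. schwartz_seminorm k m (\<lambda>x. g x - f x) < \<epsilon>} | f k m \<epsilon>.
        f \<in> schwartz_space \<and> \<epsilon> > 0}"

definition tempered_distribution :: "((real \<Rightarrow> real) \<Rightarrow> real) \<Rightarrow> bool" where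
  "tempered_distribution L \<longleftrightarrow>
     (\<forall>f\<in>schwartz_space. \<forall>g\<in>schwartz_space. L (\<lambda>x. f x + g x) = L f + L g) \<and>
     (\<forall>c. \<forall>f\<in>schwartz_space. L (\<lambda>x. c * f x) = c * L f) \<and>
     continuous_map schwartz_topology euclideanreal L"

text \<open>
  For a functional \<open>T\<close> of which only the values on test functions matter. Membership of \<open>T\<close>
  in the space of distributions need not be required separately: the restriction of a tempered
  distribution to the test functions is always a distribution.
\<close>

definition extends_to_tempered :: "((real \<Rightarrow> real) \<Rightarrow> real) \<Rightarrow> bool" where
  "extends_to_tempered T \<longleftrightarrow>
     (\<exists>L. tempered_distribution L \<and> (\<forall>\<phi>\<in>test_functions. L \<phi> = T \<phi>))"

section \<open>Levy white noise\<close>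

definition levy_white_noise :: "(real \<Rightarrow> 'a \<Rightarrow> real) \<Rightarrow> 'a \<Rightarrow> (real \<Rightarrow> real) \<Rightarrow> real" where
  "levy_white_noise X \<omega> \<phi> = - (LBINT t:{0..}. X t \<omega> * deriv \<phi> t)"

definition tempered_event :: "'a measure \<Rightarrow> (real \<Rightarrow> 'a \<Rightarrow> real) \<Rightarrow> 'a set" where
  "tempered_event M X = {\<omega> \<in> space M. extends_to_tempered (levy_white_noise X \<omega>)}"

end

theory Submission
  imports Defs
begin

text \<open>
  Both directions compare the white noise with the tail sums
  \<open>\<Sum>n. P(\<bar>X 1\<bar> > b * (n + 1) ^ q)\<close>, which are finite for some \<open>q\<close> if and only if \<open>X 1\<close> has
  a finite moment of some positive order (\<open>summable_tail_if_moment\<close>,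
  \<open>moment_if_summable_tail\<close>).  The comparison rests on independence and stationarity of the
  increments and on the regularity of the paths.

  If some moment is finite, then so is such a tail sum, with \<open>b = 1\<close>.  Ottaviani's inequality
  transfers the tail of \<open>X 1\<close> to the oscillation of the path over \<open>{n..n + 1}\<close>, uniformly in \<open>n\<close>
  (\<open>levy_maximal_inequality\<close>); the intermediate increments that it asks to be tight are
  tight because every cadlag path is bounded on compact intervals.  By Borel--Cantelli the
  oscillations are eventually at most \<open>2 * (n + 1) ^ p\<close>, so almost every path grows at most
  polynomially (\<open>levy_poly_growth_AE\<close>), and integration against the derivative of a
  Schwartz function is then a tempered distribution (\<open>white_noise_tempered_if_poly_growth\<close>).

  Conversely, fix a smooth plateau, equal to \<open>1\<close> on \<open>{1..2}\<close> and to \<open>0\<close> outside \<open>{0..3}\<close>, and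
  let \<open>Z n\<close> be the white noise on its translate by \<open>3 n\<close>.  The Schwartz seminorms of these
  translates grow polynomially, so a tempered white noise satisfies
  \<open>\<bar>Z n\<bar> \<le> N * (n + 1) ^ N\<close> for some \<open>N\<close> and all \<open>n\<close>
  (\<open>tempered_plateau_translates_poly_bound\<close>).  Now \<open>Z n\<close> is the limit of weighted sums
  of dyadic increments.  Such a sum splits into the increment of \<open>X\<close> over the plateau, which is
  distributed like \<open>X 1\<close>, and an independent contribution of the two flanks, which stays
  bounded with probability at least one half; hence its tail is at least half the tail of
  \<open>X 1\<close> (\<open>dyadic_noise_tail\<close>).  For different \<open>n\<close> the sums are independent.  If
  \<open>X 1\<close> has no finite moment of positive order, all the tail sums diverge, and the second
  Borel--Cantelli argument gives every polynomial bound on the \<open>Z n\<close> probability zero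
  (\<open>white_noise_bounds_null\<close>).  Completeness of the measure makes the event itself
  measurable.
\<close>

section \<open>Smooth functions\<close>

text \<open>
  The derivative of a product or of a reciprocal is built from the functions themselves and
  their first derivatives by sums, products and reciprocals.  Peeling off the first
  derivative, instead of fixing the highest one, turns this into an induction on the order.
\<close>

primrec diff_order :: "nat \<Rightarrow> (real \<Rightarrow> real) \<Rightarrow> bool" where
  "diff_order 0 f = True"
| "diff_order (Suc n) f = ((\<forall>x. f differentiable at x) \<and> diff_order n (deriv f))"

lemma diff_order_iff:
  "diff_order n f \<longleftrightarrow> (\<forall>k<n. \<forall>x. (deriv ^^ k) f differentiable at x)"
proof (induction n arbitrary: f)
  case (Suc n)
  have "(\<forall>k<Suc n. \<forall>x. (deriv ^^ k) f differentiable at x) \<longleftrightarrow>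
      (\<forall>x. f differentiable at x) \<and> (\<forall>k<n. \<forall>x. (deriv ^^ Suc k) f differentiable at x)"
    unfolding All_less_Suc2 by simp
  then show ?case
    unfolding diff_order.simps Suc.IH by (simp add: funpow_Suc_right del: funpow.simps)
qed simp

lemma smooth_iff_diff_order: "smooth f \<longleftrightarrow> (\<forall>n. diff_order n f)"
  unfolding smooth_def diff_order_iff by (meson lessI)

lemma smooth_differentiable: "smooth f \<Longrightarrow> f differentiable at x"
  unfolding smooth_def by (metis funpow_0)

lemma smooth_DERIV: "smooth f \<Longrightarrow> (f has_field_derivative deriv f x) (at x)"
  using smooth_differentiable DERIV_deriv_iff_real_differentiable by blast

lemma smooth_deriv: "smooth f \<Longrightarrow> smooth (deriv f)"
  unfolding smooth_iff_diff_order using diff_order.simps(2) by blast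

lemma smooth_funpow_deriv: "smooth f \<Longrightarrow> smooth ((deriv ^^ m) f)"
  by (induction m) (auto intro: smooth_deriv)

lemma smooth_continuous: "smooth f \<Longrightarrow> continuous_on A f"
  by (meson DERIV_isCont continuous_at_imp_continuous_on smooth_DERIV)

lemma diff_order_Suc_mono: "diff_order (Suc n) f \<Longrightarrow> diff_order n f"
  unfolding diff_order_iff by auto

lemma diff_order_SucI:
  assumes "\<And>x. (f has_field_derivative f' x) (at x)" "diff_order n f'"
  shows "diff_order (Suc n) f"
proof -
  have "deriv f = f'" using assms(1) DERIV_imp_deriv by blast
  then show ?thesis
    using assms real_differentiable_def by auto
qed

lemma diff_order_DERIV:
  "diff_order (Suc n) f \<Longrightarrow> (f has_field_derivative deriv f x) (at x)"
  using DERIV_deriv_iff_real_differentiable by auto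

lemma diff_order_const: "diff_order n (\<lambda>x. c)"
proof (induction n arbitrary: c)
  case (Suc n)
  then show ?case by (intro diff_order_SucI[where f'="\<lambda>x. 0"]) auto
qed simp

lemma diff_order_add:
  "diff_order n f \<Longrightarrow> diff_order n g \<Longrightarrow> diff_order n (\<lambda>x. f x + g x)"
proof (induction n arbitrary: f g)
  case (Suc n)
  show ?case
    by (rule diff_order_SucI[where f'="\<lambda>x. deriv f x + deriv g x"])
      (use Suc in \<open>auto intro!: DERIV_add diff_order_DERIV\<close>)
qed simp

lemma diff_order_mult:
  "diff_order n f \<Longrightarrow> diff_order n g \<Longrightarrow> diff_order n (\<lambda>x. f x * g x)"
proof (induction n arbitrary: f g)
  case (Suc n)
  show ?case
  proof (rule diff_order_SucI[where f'="\<lambda>x. deriv f x * g x + deriv g x * f x"])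
    show "((\<lambda>x. f x * g x) has_field_derivative deriv f x * g x + deriv g x * f x) (at x)" for x
      using Suc.prems by (intro DERIV_mult diff_order_DERIV)
    show "diff_order n (\<lambda>x. deriv f x * g x + deriv g x * f x)"
      using Suc.prems by (intro diff_order_add Suc.IH) (auto intro: diff_order_Suc_mono)
  qed
qed simp

lemma diff_order_inverse:
  "diff_order n f \<Longrightarrow> (\<And>x. f x \<noteq> 0) \<Longrightarrow> diff_order n (\<lambda>x. inverse (f x))"
proof (induction n)
  case (Suc n)
  have inv: "diff_order n (\<lambda>x. inverse (f x))"
    using Suc diff_order_Suc_mono by blast
  show ?case
  proof (rule diff_order_SucI[where f'="\<lambda>x. (- 1) * (inverse (f x) * deriv f x * inverse (f x))"])
    show "((\<lambda>x. inverse (f x)) has_field_derivative (- 1) * (inverse (f x) * deriv f x * inverse (f x))) (at x)" for x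
      using DERIV_inverse'[OF diff_order_DERIV[OF Suc.prems(1)] Suc.prems(2), of x] by simp
    show "diff_order n (\<lambda>x. (- 1) * (inverse (f x) * deriv f x * inverse (f x)))"
      using Suc.prems(1) inv by (intro diff_order_mult diff_order_const) auto
  qed
qed simp

lemma diff_order_affine: "diff_order n f \<Longrightarrow> diff_order n (\<lambda>x. f (a * x + b))"
proof (induction n arbitrary: f)
  case (Suc n)
  show ?case
  proof (rule diff_order_SucI[where f'="\<lambda>x. deriv f (a * x + b) * a"])
    show "((\<lambda>x. f (a * x + b)) has_field_derivative deriv f (a * x + b) * a) (at x)" for x
      by (rule DERIV_chain2[OF diff_order_DERIV[OF Suc.prems]])
        (auto intro!: derivative_eq_intros)
    show "diff_order n (\<lambda>x. deriv f (a * x + b) * a)"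
      using Suc by (intro diff_order_mult diff_order_const) auto
  qed
qed simp

lemma smooth_const: "smooth (\<lambda>x. c)"
  by (simp add: smooth_iff_diff_order diff_order_const)

lemma smooth_add: "smooth f \<Longrightarrow> smooth g \<Longrightarrow> smooth (\<lambda>x. f x + g x)"
  by (simp add: smooth_iff_diff_order diff_order_add)

lemma smooth_mult: "smooth f \<Longrightarrow> smooth g \<Longrightarrow> smooth (\<lambda>x. f x * g x)"
  by (simp add: smooth_iff_diff_order diff_order_mult)

lemma smooth_inverse: "smooth f \<Longrightarrow> (\<And>x. f x \<noteq> 0) \<Longrightarrow> smooth (\<lambda>x. inverse (f x))"
  by (simp add: smooth_iff_diff_order diff_order_inverse)

lemma smooth_affine: "smooth f \<Longrightarrow> smooth (\<lambda>x. f (a * x + b))"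
  unfolding smooth_iff_diff_order using diff_order_affine[of _ f a b] by blast

lemma funpow_deriv_lincomb:
  assumes "smooth f" "smooth g"
  shows "(deriv ^^ m) (\<lambda>x. f x + c * g x) = (\<lambda>x. (deriv ^^ m) f x + c * (deriv ^^ m) g x)"
proof (induction m)
  case (Suc m)
  have "deriv (\<lambda>x. (deriv ^^ m) f x + c * (deriv ^^ m) g x) x =
      deriv ((deriv ^^ m) f) x + c * deriv ((deriv ^^ m) g) x" for x
    by (intro DERIV_imp_deriv DERIV_add DERIV_cmult smooth_DERIV smooth_funpow_deriv assms)
  then show ?case using Suc by auto
qed simp

lemma funpow_deriv_translate:
  assumes "smooth f"
  shows "(deriv ^^ m) (\<lambda>x. f (x - s)) = (\<lambda>x. (deriv ^^ m) f (x - s))"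
proof (induction m)
  case (Suc m)
  have "deriv (\<lambda>x. (deriv ^^ m) f (x - s)) x = deriv ((deriv ^^ m) f) (x - s) * 1" for x
    by (intro DERIV_imp_deriv DERIV_chain2[OF smooth_DERIV[OF smooth_funpow_deriv[OF assms]]])
      (auto intro!: derivative_eq_intros)
  then show ?case using Suc by auto
qed simp

lemma funpow_deriv_zero: "(deriv ^^ m) (\<lambda>x. 0::real) = (\<lambda>x. 0)"
  by (induction m) auto

lemma funpow_deriv_eq_0_on_open:
  assumes "open U" "\<And>x. x \<in> U \<Longrightarrow> f x = 0" "x \<in> U"
  shows "(deriv ^^ m) f x = 0"
  using assms(3)
proof (induction m arbitrary: x)
  case (Suc m)
  have "eventually (\<lambda>y. (deriv ^^ m) f y = 0) (nhds x)"
    using Suc eventually_nhds assms(1) by blast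
  then have "deriv ((deriv ^^ m) f) x = deriv (\<lambda>_. 0) x"
    by (rule deriv_cong_ev) simp
  then show ?case by simp
qed (use assms in auto)

section \<open>A smooth plateau\<close>

text \<open>
  Letting the polynomial vary makes the family closed under differentiation, and every member
  tends to \<open>0\<close> at the origin; smoothness there follows for the whole family at once.
\<close>

definition flat_germ :: "real poly \<Rightarrow> real \<Rightarrow> real" where
  "flat_germ p x = (if x > 0 then poly p (1 / x) * exp (- (1 / x)) else 0)"

lemma flat_germ_tendsto_0: "(flat_germ p \<longlongrightarrow> 0) (at_right 0)"
proof -
  have "((\<lambda>y. poly p y / exp y) \<longlongrightarrow> 0) at_top"
  proof -
    have "((\<lambda>y. coeff p i * y ^ i / exp y) \<longlongrightarrow> 0) at_top" for i
    proof -
      have "((\<lambda>y. coeff p i * (y ^ i / exp y)) \<longlongrightarrow> coeff p i * 0) at_top"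
        by (intro tendsto_intros tendsto_power_div_exp_0)
      then show ?thesis by simp
    qed
    then have "((\<lambda>y. \<Sum>i\<le>degree p. coeff p i * y ^ i / exp y) \<longlongrightarrow> (\<Sum>i\<le>degree p. 0)) at_top"
      by (intro tendsto_sum)
    then show ?thesis by (simp add: poly_altdef sum_divide_distrib)
  qed
  then have "((\<lambda>x. poly p (inverse x) / exp (inverse x)) \<longlongrightarrow> 0) (at_right 0)"
    by (rule filterlim_compose[OF _ filterlim_inverse_at_top_right])
  moreover have "eventually (\<lambda>x. poly p (inverse x) / exp (inverse x) = flat_germ p x) (at_right 0)"
    using eventually_at_right_less[of "0::real"]
    by eventually_elim (simp add: flat_germ_def exp_minus field_simps)
  ultimately show ?thesis by (rule Lim_transform_eventually)
qed

lemma flat_germ_DERIV: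
  "(flat_germ p has_field_derivative flat_germ ([:0, 0, 1:] * (p - pderiv p)) x) (at x)"
proof -
  consider "x > 0" | "x < 0" | "x = 0" by linarith
  then show ?thesis
  proof cases
    case 1
    have "((\<lambda>x. poly p (1 / x) * exp (- (1 / x))) has_field_derivative
        flat_germ ([:0, 0, 1:] * (p - pderiv p)) x) (at x)"
      using 1 by (auto intro!: derivative_eq_intros simp: flat_germ_def field_simps power2_eq_square)
    then show ?thesis
      by (rule has_field_derivative_transform_within_open[where S="{0<..}"])
        (use 1 in \<open>auto simp: flat_germ_def\<close>)
  next
    case 2
    have "((\<lambda>x. 0) has_field_derivative flat_germ ([:0, 0, 1:] * (p - pderiv p)) x) (at x)"
      using 2 by (simp add: flat_germ_def)
    then show ?thesis
      by (rule has_field_derivative_transform_within_open[where S="{..<0}"])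
        (use 2 in \<open>auto simp: flat_germ_def\<close>)
  next
    case 3
    \<comment> \<open>the difference quotient at the origin is again a flat germ\<close>
    have "((\<lambda>h. flat_germ p h / h) \<longlongrightarrow> 0) (at_right 0)"
      by (rule Lim_transform_eventually[OF flat_germ_tendsto_0[of "[:0, 1:] * p"]])
        (auto simp: flat_germ_def eventually_at_filter)
    moreover have "((\<lambda>h. flat_germ p h / h) \<longlongrightarrow> 0) (at_left 0)"
      by (rule tendsto_eventually) (auto simp: flat_germ_def eventually_at_filter)
    ultimately have "((\<lambda>h. flat_germ p h / h) \<longlongrightarrow> 0) (at 0)"
      using filterlim_split_at by blast
    then show ?thesis using 3 by (simp add: DERIV_def flat_germ_def)
  qed
qed

lemma smooth_flat_germ: "smooth (flat_germ p)"
proof -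
  have "diff_order n (flat_germ p)" for n
  proof (induction n arbitrary: p)
    case (Suc n)
    then show ?case by (intro diff_order_SucI[OF flat_germ_DERIV])
  qed simp
  then show ?thesis by (simp add: smooth_iff_diff_order)
qed

text \<open>
  The denominator is positive everywhere, since at least one of \<open>x\<close> and \<open>1 - x\<close> is; the second
  summand vanishes for \<open>x \<ge> 1\<close>.
\<close>

definition smooth_step :: "real \<Rightarrow> real" where
  "smooth_step x = flat_germ 1 x * inverse (flat_germ 1 x + flat_germ 1 (1 - x))"

lemma smooth_smooth_step: "smooth smooth_step"
proof -
  have "flat_germ 1 x + flat_germ 1 (- 1 * x + 1) \<noteq> 0" for x
    by (auto simp: flat_germ_def add_pos_pos less_imp_neq[THEN not_sym])
  then have "smooth (\<lambda>x. flat_germ 1 x * inverse (flat_germ 1 x + flat_germ 1 (- 1 * x + 1)))"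
    by (intro smooth_mult smooth_inverse smooth_add smooth_affine smooth_flat_germ)
  then show ?thesis by (simp add: smooth_step_def[abs_def])
qed

lemma smooth_step_eq_0: "x \<le> 0 \<Longrightarrow> smooth_step x = 0"
  and smooth_step_eq_1: "x \<ge> 1 \<Longrightarrow> smooth_step x = 1"
  by (auto simp: smooth_step_def flat_germ_def)

definition plateau :: "real \<Rightarrow> real" where
  "plateau x = smooth_step x * smooth_step (3 - x)"

lemma smooth_plateau: "smooth plateau"
proof -
  have "smooth (\<lambda>x. smooth_step x * smooth_step (- 1 * x + 3))"
    by (intro smooth_mult smooth_affine smooth_smooth_step)
  then show ?thesis by (simp add: plateau_def[abs_def])
qed

lemma plateau_eq_0: "x \<le> 0 \<or> x \<ge> 3 \<Longrightarrow> plateau x = 0"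
  and plateau_eq_1: "1 \<le> x \<Longrightarrow> x \<le> 2 \<Longrightarrow> plateau x = 1"
  by (auto simp: plateau_def smooth_step_eq_0 smooth_step_eq_1)

lemma plateau_translate_test_function: "(\<lambda>x. plateau (x - s)) \<in> test_functions"
proof -
  have "smooth (\<lambda>x. plateau (1 * x + (- s)))"
    by (intro smooth_affine smooth_plateau)
  moreover have "bounded {x. plateau (x - s) \<noteq> 0}"
    proof (rule bounded_subset[of "{s..s + 3}"])
    show "{x. plateau (x - s) \<noteq> 0} \<subseteq> {s..s + 3}"
    proof
      fix x assume "x \<in> {x. plateau (x - s) \<noteq> 0}"
      then show "x \<in> {s..s + 3}" using plateau_eq_0[of "x - s"] by (cases "x \<le> s"; cases "s + 3 \<le> x") auto
    qed
  qed simp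
  ultimately show ?thesis by (simp add: test_functions_def compact_closure)
qed

lemma funpow_deriv_plateau_eq_0:
  assumes "x \<notin> {0..3}"
  shows "(deriv ^^ m) plateau x = 0"
  by (rule funpow_deriv_eq_0_on_open[of "- {0..3}"]) (use assms plateau_eq_0 in auto)

lemma funpow_deriv_plateau_bounded: "\<exists>B>0. \<forall>x. \<bar>(deriv ^^ m) plateau x\<bar> \<le> B"
proof -
  have "compact ((deriv ^^ m) plateau ` {0..3})"
    by (intro compact_continuous_image smooth_continuous smooth_funpow_deriv smooth_plateau) auto
  then obtain B where "B > 0" "\<And>x. x \<in> {0..3} \<Longrightarrow> \<bar>(deriv ^^ m) plateau x\<bar> \<le> B"
    using compact_imp_bounded bounded_pos by (metis image_eqI real_norm_def)
  then show ?thesis using funpow_deriv_plateau_eq_0 by (metis abs_zero order_less_imp_le)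
qed

section \<open>The topology of the Schwartz space\<close>

lemma schwartz_space_iff:
  "f \<in> schwartz_space \<longleftrightarrow> smooth f \<and> (\<forall>k m. \<exists>B. \<forall>x. \<bar>x ^ k * (deriv ^^ m) f x\<bar> \<le> B)"
  by (simp add: schwartz_space_def bounded_iff)

lemma schwartz_smooth: "f \<in> schwartz_space \<Longrightarrow> smooth f"
  by (simp add: schwartz_space_def)

lemma schwartz_seminorm_ge:
  assumes "f \<in> schwartz_space"
  shows "\<bar>x ^ k * (deriv ^^ m) f x\<bar> \<le> schwartz_seminorm k m f"
proof -
  obtain B where "\<And>x. \<bar>x ^ k * (deriv ^^ m) f x\<bar> \<le> B"
    using assms unfolding schwartz_space_iff by blast
  then have "bdd_above (range (\<lambda>x. \<bar>x ^ k * (deriv ^^ m) f x\<bar>))"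
    by (intro bdd_aboveI[of _ B]) auto
  then show ?thesis unfolding schwartz_seminorm_def by (rule cSUP_upper[rotated]) simp
qed

lemma schwartz_seminorm_le:
  "(\<And>x. \<bar>x ^ k * (deriv ^^ m) f x\<bar> \<le> B) \<Longrightarrow> schwartz_seminorm k m f \<le> B"
  unfolding schwartz_seminorm_def by (rule cSUP_least) auto

lemma
  assumes "f \<in> schwartz_space" "g \<in> schwartz_space"
  shows schwartz_lincomb: "(\<lambda>x. f x + c * g x) \<in> schwartz_space"
    and schwartz_seminorm_lincomb_le: "schwartz_seminorm k m (\<lambda>x. f x + c * g x) \<le>
      schwartz_seminorm k m f + \<bar>c\<bar> * schwartz_seminorm k m g"
proof -
  have le: "\<bar>x ^ k * (deriv ^^ m) (\<lambda>x. f x + c * g x) x\<bar> \<le>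
      schwartz_seminorm k m f + \<bar>c\<bar> * schwartz_seminorm k m g" for k m x
  proof -
    have "x ^ k * (deriv ^^ m) (\<lambda>x. f x + c * g x) x =
        x ^ k * (deriv ^^ m) f x + c * (x ^ k * (deriv ^^ m) g x)"
      using assms by (simp add: funpow_deriv_lincomb schwartz_smooth algebra_simps)
    then have "\<bar>x ^ k * (deriv ^^ m) (\<lambda>x. f x + c * g x) x\<bar> \<le>
        \<bar>x ^ k * (deriv ^^ m) f x\<bar> + \<bar>c\<bar> * \<bar>x ^ k * (deriv ^^ m) g x\<bar>"
      by (metis abs_mult abs_triangle_ineq)
    also have "\<dots> \<le> schwartz_seminorm k m f + \<bar>c\<bar> * schwartz_seminorm k m g"
      by (intro add_mono mult_left_mono schwartz_seminorm_ge assms) auto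
    finally show ?thesis .
  qed
  show "(\<lambda>x. f x + c * g x) \<in> schwartz_space"
    unfolding schwartz_space_iff
  proof (intro conjI allI)
    show "smooth (\<lambda>x. f x + c * g x)"
      using assms by (intro smooth_add smooth_mult smooth_const schwartz_smooth)
    show "\<exists>B. \<forall>x. \<bar>x ^ k * (deriv ^^ m) (\<lambda>x. f x + c * g x) x\<bar> \<le> B" for k m
      using le by blast
  qed
  show "schwartz_seminorm k m (\<lambda>x. f x + c * g x) \<le>
      schwartz_seminorm k m f + \<bar>c\<bar> * schwartz_seminorm k m g"
    by (rule schwartz_seminorm_le) (rule le)
qed

lemma zero_schwartz: "(\<lambda>x. 0) \<in> schwartz_space"
  by (simp add: schwartz_space_def smooth_const funpow_deriv_zero)

lemma schwartz_seminorm_0: "schwartz_seminorm k m (\<lambda>x. 0) = 0"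
  by (simp add: schwartz_seminorm_def funpow_deriv_zero)

lemma topspace_schwartz: "topspace schwartz_topology = schwartz_space"
proof (intro equalityI subsetI)
  fix f assume f: "f \<in> schwartz_space"
  have "openin schwartz_topology {g \<in> schwartz_space. schwartz_seminorm 0 0 (\<lambda>x. g x - f x) < 1}"
    unfolding schwartz_topology_def
    by (rule topology_generated_by_Basis) (use f zero_less_one in blast)
  from openin_subset[OF this] show "f \<in> topspace schwartz_topology"
    using f by (auto simp: schwartz_seminorm_0)
qed (auto simp: schwartz_topology_def)

text \<open>
  A basic neighbourhood that contains \<open>0\<close> may be centred elsewhere; by the triangle inequality
  it still absorbs every sequence whose seminorms all tend to \<open>0\<close>.
\<close>

lemma tempered_tendsto_0:
  assumes L: "tempered_distribution L"
    and \<psi>: "\<And>n. \<psi> n \<in> schwartz_space"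
    and lim: "\<And>k m. (\<lambda>n. schwartz_seminorm k m (\<psi> n)) \<longlonglongrightarrow> 0"
  shows "(\<lambda>n. L (\<psi> n)) \<longlonglongrightarrow> 0"
proof (rule tendstoI)
  fix e :: real assume e: "e > 0"
  let ?B = "{{g \<in> schwartz_space. schwartz_seminorm k m (\<lambda>x. g x - f x) < \<epsilon>} | f k m \<epsilon>.
        f \<in> schwartz_space \<and> \<epsilon> > 0}"
  have ev: "eventually (\<lambda>n. \<psi> n \<in> U) sequentially"
    if "generate_topology_on ?B U" "(\<lambda>x. 0) \<in> U" for U
    using that
  proof induction
    case (Int a b)
    then show ?case by (simp add: eventually_conj_iff)
  next
    case (UN K)
    then obtain k where "k \<in> K" "eventually (\<lambda>n. \<psi> n \<in> k) sequentially" by auto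
    then show ?case by (metis (mono_tags, lifting) UnionI eventually_mono)
  next
    case (Basis U)
    then obtain f k m \<epsilon> where f: "f \<in> schwartz_space" "\<epsilon> > 0"
      and U: "U = {g \<in> schwartz_space. schwartz_seminorm k m (\<lambda>x. g x - f x) < \<epsilon>}" by blast
    define r where "r = schwartz_seminorm k m (\<lambda>x. 0 - f x)"
    have r: "r < \<epsilon>" using Basis.prems by (simp add: U r_def)
    have "eventually (\<lambda>n. schwartz_seminorm k m (\<psi> n) < \<epsilon> - r) sequentially"
      using lim[of k m] r by (intro order_tendstoD) auto
    then show ?case
    proof eventually_elim
      case (elim n)
      have "(\<lambda>x. 0 - f x) \<in> schwartz_space"
        using schwartz_lincomb[OF zero_schwartz f(1), of "-1"] by simp
      then have "schwartz_seminorm k m (\<lambda>x. \<psi> n x + 1 * (0 - f x)) \<le> schwartz_seminorm k m (\<psi> n) + \<bar>1\<bar> * r"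
        unfolding r_def by (intro schwartz_seminorm_lincomb_le \<psi>)
      then show ?case using elim \<psi> by (simp add: U)
    qed
  qed auto
  have 0: "L (\<lambda>x. 0) = 0"
  proof -
    have "\<forall>c. \<forall>f\<in>schwartz_space. L (\<lambda>x. c * f x) = c * L f"
      using L unfolding tempered_distribution_def by blast
    from bspec[OF spec[OF this, of 0] zero_schwartz] show ?thesis by simp
  qed
  have "openin schwartz_topology {f \<in> topspace schwartz_topology. L f \<in> ball 0 e}"
    using L unfolding tempered_distribution_def by (intro openin_continuous_map_preimage[of _ euclidean]) auto
  then have "generate_topology_on ?B {f \<in> schwartz_space. L f \<in> ball 0 e}"
    unfolding topspace_schwartz unfolding schwartz_topology_def openin_topology_generated_by_iff .
  from ev[OF this] show "eventually (\<lambda>n. dist (L (\<psi> n)) 0 < e) sequentially"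
    using e 0 zero_schwartz by (auto simp: dist_commute elim!: eventually_mono)
qed

text \<open>
  Two seminorms suffice for the white noise of a path of polynomial growth: one for small and
  one for large times.
\<close>

lemma tempered_if_seminorm_bound:
  assumes add: "\<And>f g. f \<in> schwartz_space \<Longrightarrow> g \<in> schwartz_space \<Longrightarrow> L (\<lambda>x. f x + g x) = L f + L g"
    and mult: "\<And>c f. f \<in> schwartz_space \<Longrightarrow> L (\<lambda>x. c * f x) = c * L f"
    and bound: "\<And>f. f \<in> schwartz_space \<Longrightarrow>
      \<bar>L f\<bar> \<le> C * (schwartz_seminorm k m f + schwartz_seminorm k' m' f)"
  shows "tempered_distribution L"
proof -
  have "openin schwartz_topology {f \<in> schwartz_space. L f \<in> U}" if "open U" for U
  proof (subst openin_subopen, intro ballI)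
    fix f assume "f \<in> {f \<in> schwartz_space. L f \<in> U}"
    then have f: "f \<in> schwartz_space" "L f \<in> U" by auto
    then obtain e where e: "e > 0" "ball (L f) e \<subseteq> U" using \<open>open U\<close> by (auto elim: openE)
    define K where "K = \<bar>C\<bar> + 1"
    have K: "K > 0" "C \<le> K" unfolding K_def by linarith+
    define d where "d = e / K / 2"
    have d: "d > 0" using e K by (simp add: d_def)
    define V where "V k m = {g \<in> schwartz_space. schwartz_seminorm k m (\<lambda>x. g x - f x) < d}" for k m
    have V: "openin schwartz_topology (V k m)" for k m
      unfolding schwartz_topology_def V_def
      by (rule topology_generated_by_Basis) (use f d in blast)
    have "L g \<in> U" if "g \<in> V k m \<inter> V k' m'" for g
    proof -
      have g: "g \<in> schwartz_space" "schwartz_seminorm k m (\<lambda>x. g x - f x) < d"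
        "schwartz_seminorm k' m' (\<lambda>x. g x - f x) < d" using that by (auto simp: V_def)
      have gf: "(\<lambda>x. g x - f x) \<in> schwartz_space"
        using schwartz_lincomb[OF g(1) f(1), of "-1"] by simp
      have "L g = L f + L (\<lambda>x. g x - f x)" using add[OF f(1) gf] by simp
      moreover have "\<bar>L (\<lambda>x. g x - f x)\<bar> < e"
      proof -
        have p: "0 \<le> schwartz_seminorm k m (\<lambda>x. g x - f x)" for k m
          using schwartz_seminorm_ge[OF gf, of 0 k m] by linarith
        have "\<bar>L (\<lambda>x. g x - f x)\<bar> \<le> C * (schwartz_seminorm k m (\<lambda>x. g x - f x) + schwartz_seminorm k' m' (\<lambda>x. g x - f x))"
          by (rule bound[OF gf])
        also have "\<dots> \<le> K * (schwartz_seminorm k m (\<lambda>x. g x - f x) + schwartz_seminorm k' m' (\<lambda>x. g x - f x))"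
          by (intro mult_right_mono add_nonneg_nonneg p K)
        also have "\<dots> < K * (d + d)"
          using g K by (intro mult_strict_left_mono add_strict_mono)
        also have "\<dots> = e" using K by (simp add: d_def)
        finally show ?thesis .
      qed
      ultimately have "L g \<in> ball (L f) e" by (simp add: dist_real_def)
      then show ?thesis using e by auto
    qed
    moreover have "f \<in> V k m \<inter> V k' m'"
      using f d by (simp add: V_def schwartz_seminorm_0)
    moreover have "V k m \<subseteq> schwartz_space" by (auto simp: V_def)
    ultimately show "\<exists>T. openin schwartz_topology T \<and> f \<in> T \<and> T \<subseteq> {f \<in> schwartz_space. L f \<in> U}"
      using V by (intro exI[of _ "V k m \<inter> V k' m'"]) auto
  qed
  then have "continuous_map schwartz_topology euclideanreal L"
    by (auto simp: continuous_map_def topspace_schwartz)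
  then show ?thesis using add mult by (auto simp: tempered_distribution_def)
qed

text \<open>
  The translates by \<open>3 n\<close> have seminorms growing polynomially in \<open>n\<close>.  If no power of \<open>n\<close>
  dominated their images, then dividing suitable translates by their images would give a null
  sequence in the Schwartz space on which the functional has modulus one.
\<close>

lemma tempered_plateau_translates_poly_bound:
  assumes L: "tempered_distribution L"
  shows "\<exists>N::nat. \<forall>n. \<bar>L (\<lambda>x. plateau (x - 3 * real n))\<bar> \<le> real N * (real n + 1) ^ N"
proof (rule ccontr)
  let ?\<phi> = "\<lambda>n x. plateau (x - 3 * real n)"
  assume "\<not> ?thesis"
  then have "\<forall>N. \<exists>n. \<bar>L (?\<phi> n)\<bar> > real N * (real n + 1) ^ N"
    by (auto simp: not_le)
  then obtain n where n: "\<And>N. \<bar>L (?\<phi> (n N))\<bar> > real N * (real (n N) + 1) ^ N" by metis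
  have dphi: "(deriv ^^ m) (?\<phi> n) x = (deriv ^^ m) plateau (x - 3 * real n)" for m n x
    by (simp add: funpow_deriv_translate smooth_plateau)
  have bnd: "\<exists>B>0. \<forall>n x. \<bar>x ^ k * (deriv ^^ m) (?\<phi> n) x\<bar> \<le> B * (real n + 1) ^ k" for k m
  proof -
    obtain B where B: "B > 0" "\<And>x. \<bar>(deriv ^^ m) plateau x\<bar> \<le> B"
      using funpow_deriv_plateau_bounded by blast
    \<comment> \<open>on the support of the translate, \<open>\<bar>x\<bar> \<le> 3 * n + 3\<close>\<close>
    have "\<bar>x ^ k * (deriv ^^ m) (?\<phi> n) x\<bar> \<le> (B * 3 ^ k) * (real n + 1) ^ k" for n x
    proof (cases "x - 3 * real n \<in> {0..3}")
      case True
      then have "\<bar>x\<bar> ^ k \<le> (3 * (real n + 1)) ^ k" by (intro power_mono) auto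
      then have "\<bar>x\<bar> ^ k * \<bar>(deriv ^^ m) plateau (x - 3 * real n)\<bar> \<le> (3 * (real n + 1)) ^ k * B"
        by (intro mult_mono B) auto
      then show ?thesis
        unfolding dphi abs_mult power_abs power_mult_distrib by (simp only: mult_ac)
    next
      case False
      then show ?thesis using B by (simp add: dphi funpow_deriv_plateau_eq_0)
    qed
    then show ?thesis using B by (intro exI[of _ "B * 3 ^ k"]) auto
  qed
  have S: "?\<phi> n \<in> schwartz_space" for n
  proof -
    have "\<exists>B. \<forall>x. \<bar>x ^ k * (deriv ^^ m) (?\<phi> n) x\<bar> \<le> B" for k m
      using bnd[of k m] by blast
    moreover have "smooth (?\<phi> n)"
      using plateau_translate_test_function by (auto simp: test_functions_def)
    ultimately show ?thesis by (simp add: schwartz_space_iff)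
  qed
  define \<psi> where "\<psi> N x = inverse (L (?\<phi> (n N))) * ?\<phi> (n N) x" for N x
  have \<psi>S: "\<psi> N \<in> schwartz_space" for N
    using schwartz_lincomb[OF zero_schwartz S, of "inverse (L (?\<phi> (n N)))" "n N"]
    by (simp add: \<psi>_def[abs_def])
  have Lpos: "L (?\<phi> (n N)) \<noteq> 0" for N
  proof -
    have "0 \<le> real N * (real (n N) + 1) ^ N" by simp
    then show ?thesis using n[of N] by linarith
  qed
  have mult: "\<And>c f. f \<in> schwartz_space \<Longrightarrow> L (\<lambda>x. c * f x) = c * L f"
    using L unfolding tempered_distribution_def by blast
  have L1: "L (\<psi> N) = 1" for N
  proof -
    have "L (\<psi> N) = inverse (L (?\<phi> (n N))) * L (?\<phi> (n N))"
      unfolding \<psi>_def[abs_def] by (rule mult[OF S])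
    then show ?thesis using Lpos by simp
  qed
  have "(\<lambda>N. schwartz_seminorm k m (\<psi> N)) \<longlonglongrightarrow> 0" for k m
  proof -
    obtain B where B: "B > 0" "\<And>n x. \<bar>x ^ k * (deriv ^^ m) (?\<phi> n) x\<bar> \<le> B * (real n + 1) ^ k"
      using bnd by blast
    have le: "schwartz_seminorm k m (\<psi> N) \<le> B / real N" if N: "N \<ge> max 1 k" for N
    proof (rule schwartz_seminorm_le)
      fix x
      have "(deriv ^^ m) (\<psi> N) x = inverse (L (?\<phi> (n N))) * (deriv ^^ m) (?\<phi> (n N)) x"
        using funpow_deriv_lincomb[OF smooth_const schwartz_smooth[OF S], of m 0 "inverse (L (?\<phi> (n N)))" "n N"]
        by (simp add: \<psi>_def[abs_def] funpow_deriv_zero)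
      then have "\<bar>x ^ k * (deriv ^^ m) (\<psi> N) x\<bar> = \<bar>x ^ k * (deriv ^^ m) (?\<phi> (n N)) x\<bar> / \<bar>L (?\<phi> (n N))\<bar>"
        by (simp add: abs_mult divide_inverse)
      also have "\<dots> \<le> (B * (real (n N) + 1) ^ N) / (real N * (real (n N) + 1) ^ N)"
      proof (intro frac_le)
        have "B * (real (n N) + 1) ^ k \<le> B * (real (n N) + 1) ^ N"
          using N B by (intro mult_left_mono power_increasing) auto
        with B(2) show "\<bar>x ^ k * (deriv ^^ m) (?\<phi> (n N)) x\<bar> \<le> B * (real (n N) + 1) ^ N"
          by (rule order_trans)
        show "0 \<le> B * (real (n N) + 1) ^ N" using B(1) by simp
        show "0 < real N * (real (n N) + 1) ^ N"
          using N by (intro mult_pos_pos zero_less_power) auto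
        show "real N * (real (n N) + 1) ^ N \<le> \<bar>L (?\<phi> (n N))\<bar>" using n[of N] by (rule less_imp_le)
      qed
      also have "\<dots> = B / real N" by (rule mult_divide_mult_cancel_right) simp
      finally show "\<bar>x ^ k * (deriv ^^ m) (\<psi> N) x\<bar> \<le> B / real N" .
    qed
    have ge: "0 \<le> schwartz_seminorm k m (\<psi> N)" for N
      using schwartz_seminorm_ge[OF \<psi>S, of 0 k m N] by linarith
    show ?thesis
    proof (rule real_tendsto_sandwich)
      show "eventually (\<lambda>N. 0 \<le> schwartz_seminorm k m (\<psi> N)) sequentially"
        by (rule always_eventually) (rule allI, rule ge)
      show "eventually (\<lambda>N. schwartz_seminorm k m (\<psi> N) \<le> B / real N) sequentially"
        by (rule eventually_sequentiallyI[of "max 1 k"]) (rule le)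
      show "(\<lambda>N. B / real N) \<longlonglongrightarrow> 0" by (rule lim_const_over_n)
    qed (rule tendsto_const)
  qed
  then have "(\<lambda>N. L (\<psi> N)) \<longlonglongrightarrow> 0" by (rule tempered_tendsto_0[OF L \<psi>S])
  then show False by (simp add: L1 LIMSEQ_const_iff)
qed

section \<open>Cadlag paths\<close>

lemma cadlag_right: "cadlag x \<Longrightarrow> t \<ge> 0 \<Longrightarrow> (x \<longlongrightarrow> x t) (at_right t)"
  by (simp add: cadlag_def)

text \<open>
  The one-sided limits bound the path near each point; compactness, in the form of Bolzano's
  bisection principle, makes the bound uniform.
\<close>

lemma cadlag_bounded:
  assumes "cadlag x"
  shows "\<exists>B\<ge>0. \<forall>t\<in>{0..T}. \<bar>x t\<bar> \<le> B"
proof (cases "0 \<le> T")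
  case True
  have "\<exists>B. \<forall>t\<in>{0..T}. 0 \<le> t \<longrightarrow> \<bar>x t\<bar> \<le> B"
  proof (rule Bolzano[of 0 T "\<lambda>u v. \<exists>B. \<forall>t\<in>{u..v}. 0 \<le> t \<longrightarrow> \<bar>x t\<bar> \<le> B"])
    fix a b c :: real assume "a \<le> b" "b \<le> c"
      "\<exists>B. \<forall>t\<in>{a..b}. 0 \<le> t \<longrightarrow> \<bar>x t\<bar> \<le> B" "\<exists>B. \<forall>t\<in>{b..c}. 0 \<le> t \<longrightarrow> \<bar>x t\<bar> \<le> B"
    then obtain B B' where "\<And>t. t \<in> {a..b} \<Longrightarrow> 0 \<le> t \<Longrightarrow> \<bar>x t\<bar> \<le> B"
      "\<And>t. t \<in> {b..c} \<Longrightarrow> 0 \<le> t \<Longrightarrow> \<bar>x t\<bar> \<le> B'" by blast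
    then have "\<bar>x t\<bar> \<le> max B B'" if "t \<in> {a..c}" "0 \<le> t" for t
      using that by (cases "t \<le> b") (simp_all add: le_max_iff_disj)
    then show "\<exists>B. \<forall>t\<in>{a..c}. 0 \<le> t \<longrightarrow> \<bar>x t\<bar> \<le> B" by blast
  next
    fix s assume s: "0 \<le> s" "s \<le> T"
    have "eventually (\<lambda>t. dist (x t) (x s) < 1) (at_right s)"
      using cadlag_right[OF assms s(1)] by (rule tendstoD) simp
    then obtain u where u: "u > s" "\<And>t. s < t \<Longrightarrow> t < u \<Longrightarrow> dist (x t) (x s) < 1"
      by (auto simp: eventually_at_right_field)
    have "\<exists>v<s. \<exists>l. \<forall>t. 0 \<le> t \<longrightarrow> v < t \<longrightarrow> t < s \<longrightarrow> dist (x t) l < 1"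
    proof (cases "s = 0")
      case True
      \<comment> \<open>there are no times before \<open>0\<close>, so any \<open>v < 0\<close> will do\<close>
      then show ?thesis by (intro exI[of _ "-1"]) auto
    next
      case False
      then have "s > 0" using s by simp
      then obtain l where "(x \<longlongrightarrow> l) (at_left s)"
        using assms unfolding cadlag_def by blast
      then have "eventually (\<lambda>t. dist (x t) l < 1) (at_left s)" by (rule tendstoD) simp
      then show ?thesis by (auto simp: eventually_at_left_field)
    qed
    then obtain v l where v: "v < s" "\<And>t. 0 \<le> t \<Longrightarrow> v < t \<Longrightarrow> t < s \<Longrightarrow> dist (x t) l < 1" by blast
    define B where "B = \<bar>x s\<bar> + \<bar>l\<bar> + 1"
    have B: "\<bar>x t\<bar> \<le> B" if "v < t" "t < u" "0 \<le> t" for t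
    proof -
      consider "t < s" | "t = s" | "t > s" by linarith
      then show ?thesis
      proof cases
        case 1
        then show ?thesis using v(2)[of t] that by (simp add: B_def dist_real_def)
      next
        case 3
        then show ?thesis using u(2)[of t] that by (simp add: B_def dist_real_def)
      qed (simp add: B_def)
    qed
    have "\<forall>t\<in>{a..b}. 0 \<le> t \<longrightarrow> \<bar>x t\<bar> \<le> B"
      if "a \<le> s \<and> s \<le> b \<and> b - a < min (s - v) (u - s)" for a b
    proof (intro ballI impI B)
      fix t assume "t \<in> {a..b}"
      then show "v < t" "t < u" using that by auto
    qed
    moreover have "min (s - v) (u - s) > 0" using u(1) v(1) by simp
    ultimately show "\<exists>d>0. \<forall>a b. a \<le> s \<and> s \<le> b \<and> b - a < d \<longrightarrow>
        (\<exists>B. \<forall>t\<in>{a..b}. 0 \<le> t \<longrightarrow> \<bar>x t\<bar> \<le> B)" by blast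
  qed (use True in auto)
  then obtain B where "\<forall>t\<in>{0..T}. \<bar>x t\<bar> \<le> B" by auto
  then have "\<forall>t\<in>{0..T}. \<bar>x t\<bar> \<le> \<bar>B\<bar>" by force
  then show ?thesis by (metis abs_ge_zero)
qed auto

definition next_dyadic :: "nat \<Rightarrow> real \<Rightarrow> real" where
  "next_dyadic m t = (real_of_int \<lfloor>t * 2 ^ m\<rfloor> + 1) / 2 ^ m"

lemma next_dyadic_gt: "t < next_dyadic m t"
  unfolding next_dyadic_def by (simp add: pos_less_divide_eq)

lemma next_dyadic_le: "next_dyadic m t \<le> t + 1 / 2 ^ m"
proof -
  have "real_of_int \<lfloor>t * 2 ^ m\<rfloor> + 1 \<le> (t + 1 / 2 ^ m) * 2 ^ m"
    by (simp add: distrib_right)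
  then show ?thesis unfolding next_dyadic_def by (simp add: pos_divide_le_eq)
qed

text \<open>
  Dyadic approximation is always from the strict right, the side on which cadlag paths
  are continuous.
\<close>

lemma cadlag_next_dyadic:
  assumes "cadlag x" "t \<ge> 0"
  shows "(\<lambda>m. x (next_dyadic m t)) \<longlonglongrightarrow> x t"
proof -
  have "(\<lambda>m. t + (1 / 2) ^ m) \<longlonglongrightarrow> t + 0"
    by (intro tendsto_intros LIMSEQ_power_zero) auto
  then have up: "(\<lambda>m. t + 1 / 2 ^ m) \<longlonglongrightarrow> t" by (simp add: power_one_over)
  have "(\<lambda>m. next_dyadic m t) \<longlonglongrightarrow> t"
    by (rule real_tendsto_sandwich[OF _ _ tendsto_const up])
      (auto intro!: always_eventually simp: next_dyadic_le less_imp_le[OF next_dyadic_gt])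
  then have "filterlim (\<lambda>m. next_dyadic m t) (at_right t) sequentially"
    unfolding filterlim_at
    by (auto intro!: always_eventually simp: next_dyadic_gt less_imp_neq[OF next_dyadic_gt, THEN not_sym])
  with cadlag_right[OF assms] show ?thesis by (rule filterlim_compose)
qed

lemma cadlag_borel_measurable:
  assumes "cadlag x"
  shows "(\<lambda>t. indicator {0..} t * x t) \<in> borel_measurable borel"
proof (rule borel_measurable_LIMSEQ_real)
  show "(\<lambda>m. indicator {0..} t * x (next_dyadic m t)) \<longlonglongrightarrow> indicator {0..} t * x t" for t
  proof (cases "t \<ge> 0")
    case True
    then show ?thesis by (simp add: cadlag_next_dyadic[OF assms])
  qed simp
  show "(\<lambda>t. indicator {0..} t * x (next_dyadic m t)) \<in> borel_measurable borel" for m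
  proof -
    have "(\<lambda>t::real. \<lfloor>t * 2 ^ m\<rfloor>) \<in> measurable borel (count_space UNIV)"
      by measurable
    from measurable_compose[OF this, of "\<lambda>k. x ((real_of_int k + 1) / 2 ^ m)" borel]
    have "(\<lambda>t::real. x ((real_of_int \<lfloor>t * 2 ^ m\<rfloor> + 1) / 2 ^ m)) \<in> borel_measurable borel" by simp
    then show ?thesis unfolding next_dyadic_def by (intro borel_measurable_times) auto
  qed
qed

lemma cadlag_unit_increment_le:
  assumes x: "cadlag x"
    and K: "\<And>m i. i \<le> 2 ^ m \<Longrightarrow> \<bar>x (real n + real i / 2 ^ m) - x (real n)\<bar> \<le> K"
    and t: "real n \<le> t" "t \<le> real n + 1"
  shows "\<bar>x t - x (real n)\<bar> \<le> K"
proof (cases "t = real n + 1")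
  case True
  then show ?thesis using K[of 1 0] by simp
next
  case False
  have "\<bar>x (next_dyadic m t) - x (real n)\<bar> \<le> K" for m
  proof -
    define i where "i = nat (\<lfloor>t * 2 ^ m\<rfloor> + 1 - int n * 2 ^ m)"
    have "\<lfloor>real n * 2 ^ m\<rfloor> \<le> \<lfloor>t * 2 ^ m\<rfloor>" using t by (intro floor_mono mult_right_mono) auto
    moreover have "\<lfloor>real n * 2 ^ m\<rfloor> = int n * 2 ^ m"
      by (metis floor_of_int of_int_mult of_int_numeral of_int_of_nat_eq of_int_power)
    moreover have "\<lfloor>t * 2 ^ m\<rfloor> < (int n + 1) * 2 ^ m"
      using t False by (simp add: floor_less_iff)
    ultimately have i: "i \<le> 2 ^ m" "int i = \<lfloor>t * 2 ^ m\<rfloor> + 1 - int n * 2 ^ m"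
      by (auto simp: i_def nat_le_iff algebra_simps)
    have "real i = real_of_int \<lfloor>t * 2 ^ m\<rfloor> + 1 - real n * 2 ^ m"
      using arg_cong[OF i(2), of real_of_int] by simp
    then have "real n + real i / 2 ^ m = next_dyadic m t"
      by (simp add: next_dyadic_def field_simps)
    then show ?thesis using K[OF i(1)] by simp
  qed
  moreover have "(\<lambda>m. \<bar>x (next_dyadic m t) - x (real n)\<bar>) \<longlonglongrightarrow> \<bar>x t - x (real n)\<bar>"
    using x t by (intro tendsto_intros cadlag_next_dyadic) auto
  ultimately show ?thesis by (intro LIMSEQ_le_const2) auto
qed

lemma cadlag_poly_growth:
  assumes x: "cadlag x"
    and K: "\<And>n t. n \<ge> n0 \<Longrightarrow> real n \<le> t \<Longrightarrow> t \<le> real n + 1 \<Longrightarrow>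
      \<bar>x t - x (real n)\<bar> \<le> 2 * (real n + 1) ^ p"
  shows "\<exists>C. \<forall>t\<ge>0. \<bar>x t\<bar> \<le> C * (1 + t) ^ Suc p"
proof -
  obtain B where B: "B \<ge> 0" "\<And>t. t \<in> {0..real n0} \<Longrightarrow> \<bar>x t\<bar> \<le> B"
    using cadlag_bounded[OF x] by blast
  have step: "2 * real n ^ Suc p + 2 * (real n + 1) ^ p \<le> 2 * (real n + 1) ^ Suc p" for n
  proof -
    have "real n ^ p \<le> (real n + 1) ^ p" by (intro power_mono) auto
    then have "real n * real n ^ p \<le> real n * (real n + 1) ^ p" by (intro mult_left_mono) auto
    then show ?thesis by (simp add: algebra_simps)
  qed
  have int: "\<bar>x (real n)\<bar> \<le> B + 2 * real n ^ Suc p" if "n \<ge> n0" for n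
    using that
  proof (induction n rule: dec_induct)
    case base
    have "\<bar>x (real n0)\<bar> \<le> B" by (rule B) auto
    then show ?case by (simp add: add_increasing2)
  next
    case (step n)
    have "\<bar>x (real n + 1) - x (real n)\<bar> \<le> 2 * (real n + 1) ^ p"
      using step by (intro K) auto
    then show ?case using step.IH \<open>\<And>n. 2 * real n ^ Suc p + 2 * (real n + 1) ^ p \<le> 2 * (real n + 1) ^ Suc p\<close>[of n]
      by (simp add: add.commute)
  qed
  have "\<bar>x t\<bar> \<le> (B + 2) * (1 + t) ^ Suc p" if t: "t \<ge> 0" for t
  proof (cases "t \<le> real n0")
    case True
    have one: "1 \<le> (1 + t) ^ Suc p" using t by (intro one_le_power) simp
    have "\<bar>x t\<bar> \<le> B * 1" using B(2)[of t] True t by simp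
    also have "\<dots> \<le> (B + 2) * (1 + t) ^ Suc p"
      using B one by (intro mult_mono) auto
    finally show ?thesis .
  next
    case False
    define n where "n = nat \<lfloor>t\<rfloor>"
    have n: "real n \<le> t" "t \<le> real n + 1" "n \<ge> n0"
      using t False by (auto simp: n_def le_nat_iff le_floor_iff)
    have "\<bar>x t\<bar> \<le> \<bar>x (real n)\<bar> + \<bar>x t - x (real n)\<bar>" by linarith
    also have "\<dots> \<le> B + 2 * real n ^ Suc p + 2 * (real n + 1) ^ p"
      using int[of n] K[of n t] n by linarith
    also have "\<dots> \<le> B * 1 + 2 * (real n + 1) ^ Suc p" using step[of n] by linarith
    also have "\<dots> \<le> B * (1 + t) ^ Suc p + 2 * (1 + t) ^ Suc p"
    proof (intro add_mono mult_left_mono)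
      show "1 \<le> (1 + t) ^ Suc p" using t by (intro one_le_power) simp
      show "(real n + 1) ^ Suc p \<le> (1 + t) ^ Suc p" using n by (intro power_mono) auto
    qed (use B in auto)
    finally show ?thesis by (simp add: distrib_right)
  qed
  then show ?thesis by blast
qed

section \<open>The white noise of a deterministic path\<close>

text \<open>
  With polynomial growth of the path, the defining formula of the white noise already makes
  sense on the whole Schwartz space: the integrand is dominated by a multiple of the integrable
  function \<open>1 / (1 + t\<^sup>2)\<close>, at the price of two more powers of \<open>t\<close> in the seminorm.
\<close>

lemma white_noise_tempered_if_poly_growth:
  assumes x: "cadlag x" and C: "\<And>t. t \<ge> 0 \<Longrightarrow> \<bar>x t\<bar> \<le> C * (1 + t) ^ p"
  shows "tempered_distribution (\<lambda>\<phi>. - (LBINT t:{0..}. x t * deriv \<phi> t))"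
proof -
  have C0: "C \<ge> 0" using C[of 0] by simp
  have dmeas: "deriv f \<in> borel_measurable borel" if "f \<in> schwartz_space" for f
    using that by (intro borel_measurable_continuous_onI smooth_continuous smooth_deriv schwartz_smooth)
  have bnd: "\<bar>indicator {0..} t *\<^sub>R (x t * deriv f t)\<bar> \<le>
      (C * 2 ^ (p + 2) * (schwartz_seminorm 0 1 f + schwartz_seminorm (p + 2) 1 f)) * inverse (1 + t\<^sup>2)"
    (is "_ \<le> ?K f * _") if f: "f \<in> schwartz_space" for f t
  proof (cases "t \<ge> 0")
    case True
    have "1 + t\<^sup>2 \<le> (1 + t) ^ 2" using True by (simp add: power2_sum)
    then have "(1 + t) ^ p * (1 + t\<^sup>2) \<le> (1 + t) ^ p * (1 + t) ^ 2"
      using True by (intro mult_left_mono) auto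
    also have "\<dots> = (1 + t) ^ (p + 2)" by (rule power_add[symmetric])
    also have "\<dots> \<le> (2 * max 1 t) ^ (p + 2)" using True by (intro power_mono) auto
    also have "\<dots> \<le> 2 ^ (p + 2) * (1 + t ^ (p + 2))"
      unfolding power_mult_distrib using True
      by (intro mult_left_mono; cases "t \<le> 1") (simp_all add: max_absorb1 max_absorb2)
    finally have pow: "(1 + t) ^ p * (1 + t\<^sup>2) \<le> 2 ^ (p + 2) * (1 + t ^ (p + 2))" .
    have "\<bar>x t * deriv f t\<bar> * (1 + t\<^sup>2) \<le> (C * (1 + t) ^ p * \<bar>deriv f t\<bar>) * (1 + t\<^sup>2)"
      unfolding abs_mult using C True by (intro mult_right_mono) auto
    also have "\<dots> = C * \<bar>deriv f t\<bar> * ((1 + t) ^ p * (1 + t\<^sup>2))" by simp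
    also have "\<dots> \<le> C * \<bar>deriv f t\<bar> * (2 ^ (p + 2) * (1 + t ^ (p + 2)))"
      using C0 by (intro mult_left_mono pow) auto
    also have "\<dots> = (C * 2 ^ (p + 2)) * (\<bar>t ^ 0 * (deriv ^^ 1) f t\<bar> + \<bar>t ^ (p + 2) * (deriv ^^ 1) f t\<bar>)"
      using True by (simp add: abs_mult algebra_simps)
    also have "\<dots> \<le> ?K f"
      using C0 by (intro mult_left_mono add_mono schwartz_seminorm_ge f) auto
    finally have "\<bar>x t * deriv f t\<bar> \<le> ?K f / (1 + t\<^sup>2)"
      by (subst pos_le_divide_eq) (auto simp: add_pos_nonneg)
    then show ?thesis using True by (simp add: divide_inverse)
  next
    case False
    have "0 \<le> ?K f"
      using C0 schwartz_seminorm_ge[OF f, of 0 0 1] schwartz_seminorm_ge[OF f, of 0 "p + 2" 1]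
      by (intro mult_nonneg_nonneg add_nonneg_nonneg) auto
    then show ?thesis using False by simp
  qed
  have "set_integrable lborel (einterval (-\<infinity>) \<infinity>) (\<lambda>t. inverse (1 + t\<^sup>2))"
    by (rule integrable_inverse_1_plus_square)
  then have inv: "integrable lborel (\<lambda>t::real. inverse (1 + t\<^sup>2))"
    by (simp add: set_integrable_def)
  have meas: "(\<lambda>t. indicator {0..} t *\<^sub>R (x t * deriv f t)) \<in> borel_measurable lborel"
    if "f \<in> schwartz_space" for f
  proof -
    have "(\<lambda>t. (indicator {0..} t * x t) * deriv f t) \<in> borel_measurable borel"
      by (rule borel_measurable_times[OF cadlag_borel_measurable[OF x] dmeas[OF that]])
    then show ?thesis by (simp add: mult.assoc)
  qed
  have integ: "integrable lborel (\<lambda>t. indicator {0..} t *\<^sub>R (x t * deriv f t))"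
    if f: "f \<in> schwartz_space" for f
    by (rule Bochner_Integration.integrable_bound[OF integrable_mult_right[OF inv, of "?K f"] meas[OF f]])
      (simp only: real_norm_def, rule AE_I2, rule order_trans[OF bnd[OF f] abs_ge_self])
  show ?thesis
  proof (rule tempered_if_seminorm_bound)
    fix f g assume fg: "f \<in> schwartz_space" "g \<in> schwartz_space"
    have "deriv (\<lambda>x. f x + g x) t = deriv f t + deriv g t" for t
      using fg by (intro DERIV_imp_deriv DERIV_add smooth_DERIV schwartz_smooth)
    then have "(LBINT t:{0..}. x t * deriv (\<lambda>x. f x + g x) t) =
        (LBINT t:{0..}. x t * deriv f t + x t * deriv g t)" by (simp add: distrib_left)
    also have "\<dots> = (LBINT t:{0..}. x t * deriv f t) + (LBINT t:{0..}. x t * deriv g t)"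
      by (intro set_integral_add) (unfold set_integrable_def, (rule integ, rule fg)+)
    finally show "- (LBINT t:{0..}. x t * deriv (\<lambda>x. f x + g x) t) =
        - (LBINT t:{0..}. x t * deriv f t) + - (LBINT t:{0..}. x t * deriv g t)" by simp
  next
    fix c f assume f: "f \<in> schwartz_space"
    have "deriv (\<lambda>x. c * f x) t = c * deriv f t" for t
      using f by (intro DERIV_imp_deriv DERIV_cmult smooth_DERIV schwartz_smooth)
    then have "(LBINT t:{0..}. x t * deriv (\<lambda>x. c * f x) t) = (LBINT t:{0..}. c * (x t * deriv f t))"
      by (simp add: mult.left_commute)
    then show "- (LBINT t:{0..}. x t * deriv (\<lambda>x. c * f x) t) = c * - (LBINT t:{0..}. x t * deriv f t)"
      by simp
  next
    fix f assume f: "f \<in> schwartz_space"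
    have "\<bar>LBINT t:{0..}. x t * deriv f t\<bar> \<le> (\<integral>t. \<bar>indicator {0..} t *\<^sub>R (x t * deriv f t)\<bar> \<partial>lborel)"
      unfolding set_lebesgue_integral_def by (rule integral_abs_bound)
    also have "\<dots> \<le> (\<integral>t. ?K f * inverse (1 + t\<^sup>2) \<partial>lborel)"
      by (intro integral_mono integrable_abs integ f integrable_mult_right inv bnd)
    also have "\<dots> = (C * 2 ^ (p + 2) * (\<integral>t. inverse (1 + t\<^sup>2) \<partial>lborel)) *
        (schwartz_seminorm 0 1 f + schwartz_seminorm (p + 2) 1 f)" by simp
    finally show "\<bar>- (LBINT t:{0..}. x t * deriv f t)\<bar> \<le>
        (C * 2 ^ (p + 2) * (\<integral>t. inverse (1 + t\<^sup>2) \<partial>lborel)) *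
        (schwartz_seminorm 0 1 f + schwartz_seminorm (p + 2) 1 f)" by simp
  qed
qed

lemma summation_by_parts:
  fixes y w :: "nat \<Rightarrow> real"
  shows "(\<Sum>i<M. w i * (y (Suc i) - y i)) = y M * w M - y 0 * w 0 - (\<Sum>i<M. y (Suc i) * (w (Suc i) - w i))"
  by (induction M) (auto simp: algebra_simps)

text \<open>
  The increments of \<open>y\<close> may be wild; only the oscillation of \<open>y\<close> enters, because the smooth
  weights take over the variation.
\<close>

lemma weighted_increments_le:
  fixes y w :: "nat \<Rightarrow> real"
  assumes w: "w 0 = 0" "w M = 0" and d: "\<And>i. i < M \<Longrightarrow> \<bar>w (Suc i) - w i\<bar> \<le> d"
    and K: "\<And>i. i \<le> M \<Longrightarrow> \<bar>y i - y 0\<bar> \<le> K"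
  shows "\<bar>\<Sum>i<M. w i * (y (Suc i) - y i)\<bar> \<le> real M * (K * d)"
proof -
  have K0: "K \<ge> 0" using K[of 0] by simp
  have "(\<Sum>i<M. w i * (y (Suc i) - y i)) = - (\<Sum>i<M. (y (Suc i) - y 0) * (w (Suc i) - w i))"
    using summation_by_parts[of w "\<lambda>i. y i - y 0" M] w by simp
  also have "\<bar>\<dots>\<bar> \<le> (\<Sum>i<M. \<bar>(y (Suc i) - y 0) * (w (Suc i) - w i)\<bar>)"
    by (simp add: sum_abs)
  also have "\<dots> \<le> (\<Sum>i<M. K * d)"
    unfolding abs_mult using K0 by (intro sum_mono mult_mono K d) auto
  finally show ?thesis by simp
qed

text \<open>
  Cadlag paths need not be of bounded variation, but summation by parts moves the increments
  onto the smooth test function, where right-continuity and dominated convergence apply.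
\<close>

lemma white_noise_dyadic_limit:
  assumes x: "cadlag x" and \<psi>: "smooth \<psi>" "\<And>t. t \<le> 0 \<or> t \<ge> real T \<Longrightarrow> \<psi> t = 0"
  shows "(\<lambda>m. \<Sum>i<T * 2 ^ m. \<psi> (real i / 2 ^ m) * (x (real (Suc i) / 2 ^ m) - x (real i / 2 ^ m)))
    \<longlonglongrightarrow> - (LBINT t:{0..}. x t * deriv \<psi> t)"
proof -
  \<comment> \<open>the step function that takes on each dyadic interval the value of \<open>x\<close> at its right end,
    times \<open>deriv \<psi>\<close>: it can be integrated exactly, and it converges by right-continuity\<close>
  define s where "s m t = (\<Sum>i<T * 2 ^ m. indicator {real i / 2 ^ m..<real (Suc i) / 2 ^ m} t *
      (x (real (Suc i) / 2 ^ m) * deriv \<psi> t))" for m t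
  have s: "s m t = indicator {0..<real T} t * (x (next_dyadic m t) * deriv \<psi> t)" for m t
  proof -
    have ind: "indicator {real i / 2 ^ m..<real (Suc i) / 2 ^ m} t = (if int i = \<lfloor>t * 2 ^ m\<rfloor> then 1 else (0::real))" for i
    proof -
      have "t \<in> {real i / 2 ^ m..<real (Suc i) / 2 ^ m} \<longleftrightarrow> \<lfloor>t * 2 ^ m\<rfloor> = int i"
        by (simp add: floor_eq_iff pos_divide_le_eq pos_less_divide_eq add.commute)
      then show ?thesis by (auto simp: indicator_def)
    qed
    show ?thesis
    proof (cases "t \<in> {0..<real T}")
      case True
      define k where "k = nat \<lfloor>t * 2 ^ m\<rfloor>"
      have k: "int k = \<lfloor>t * 2 ^ m\<rfloor>" using True by (simp add: k_def)
      have "\<lfloor>t * 2 ^ m\<rfloor> < int (T * 2 ^ m)"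
        using True by (simp add: floor_less_iff)
      then have kT: "k < T * 2 ^ m" using k by linarith
      have "s m t = (\<Sum>i<T * 2 ^ m. if i = k then x (real (Suc i) / 2 ^ m) * deriv \<psi> t else 0)"
        unfolding s_def ind k[symmetric] by (intro sum.cong) auto
      also have "\<dots> = x (real (Suc k) / 2 ^ m) * deriv \<psi> t" using kT by simp
      also have "real (Suc k) / 2 ^ m = next_dyadic m t"
        using arg_cong[OF k, of real_of_int] by (simp add: next_dyadic_def add.commute)
      finally show ?thesis using True by simp
    next
      case False
      have "int i \<noteq> \<lfloor>t * 2 ^ m\<rfloor>" if "i < T * 2 ^ m" for i
      proof
        assume i: "int i = \<lfloor>t * 2 ^ m\<rfloor>"
        then have "0 \<le> \<lfloor>t * 2 ^ m\<rfloor>" "\<lfloor>t * 2 ^ m\<rfloor> < int (T * 2 ^ m)" using that by linarith+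
        then have "0 \<le> t * 2 ^ m" "t * 2 ^ m < real T * 2 ^ m"
          by (simp_all add: floor_less_iff)
        then have "t < real T" by simp
        moreover have "0 \<le> t"
          using \<open>0 \<le> t * 2 ^ m\<close> mult_neg_pos[of t "2 ^ m"] by (cases "t < 0") auto
        ultimately show False using False by simp
      qed
      then have "s m t = 0" unfolding s_def ind by (intro sum.neutral) auto
      then show ?thesis using False by simp
    qed
  qed
  have cont: "isCont (deriv \<psi>) t" for t
    by (meson DERIV_isCont smooth_DERIV smooth_deriv \<psi>(1))
  have ivl: "has_bochner_integral lborel (\<lambda>t. indicator {a..<b} t * (c * deriv \<psi> t)) (c * (\<psi> b - \<psi> a))"
    if "a \<le> b" for a b c
  proof -
    have "has_bochner_integral lborel (\<lambda>t. deriv \<psi> t * indicator {a..b} t) (\<psi> b - \<psi> a)"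
      by (rule has_bochner_integral_FTC_Icc_real[OF that smooth_DERIV[OF \<psi>(1)] cont])
    then have "has_bochner_integral lborel (\<lambda>t. c * (deriv \<psi> t * indicator {a..b} t)) (c * (\<psi> b - \<psi> a))"
      by (rule has_bochner_integral_mult_right)
    moreover have "AE t in lborel. c * (deriv \<psi> t * indicator {a..b} t) = indicator {a..<b} t * (c * deriv \<psi> t)"
      using AE_lborel_singleton[of b] by eventually_elim (auto simp: indicator_def)
    moreover have "deriv \<psi> \<in> borel_measurable borel"
      by (intro borel_measurable_continuous_onI smooth_continuous smooth_deriv \<psi>)
    ultimately show ?thesis
      by (subst has_bochner_integral_cong_AE[symmetric]) auto
  qed
  have int_s: "(\<integral>t. s m t \<partial>lborel) =
      (\<Sum>i<T * 2 ^ m. x (real (Suc i) / 2 ^ m) * (\<psi> (real (Suc i) / 2 ^ m) - \<psi> (real i / 2 ^ m)))" for m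
  proof -
    have "has_bochner_integral lborel (s m)
        (\<Sum>i<T * 2 ^ m. x (real (Suc i) / 2 ^ m) * (\<psi> (real (Suc i) / 2 ^ m) - \<psi> (real i / 2 ^ m)))"
      unfolding s_def by (intro has_bochner_integral_sum ivl) (simp add: divide_right_mono)
    then show ?thesis by (rule has_bochner_integral_integral_eq)
  qed
  have parts: "(\<Sum>i<T * 2 ^ m. \<psi> (real i / 2 ^ m) * (x (real (Suc i) / 2 ^ m) - x (real i / 2 ^ m))) =
      - (\<integral>t. s m t \<partial>lborel)" for m
    using summation_by_parts[of "\<lambda>i. \<psi> (real i / 2 ^ m)" "\<lambda>i. x (real i / 2 ^ m)" "T * 2 ^ m"]
    by (simp add: int_s \<psi>(2))
  have d0: "deriv \<psi> t = 0" if "t > real T" for t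
    using funpow_deriv_eq_0_on_open[of "{real T<..}" \<psi> t 1] that \<psi>(2) by auto
  obtain B where B: "B \<ge> 0" "\<And>t. t \<in> {0..real T + 1} \<Longrightarrow> \<bar>x t\<bar> \<le> B"
    using cadlag_bounded[OF x] by blast
  have "compact (deriv \<psi> ` {0..real T})"
    by (intro compact_continuous_image smooth_continuous smooth_deriv \<psi>) auto
  then obtain D where D: "D > 0" "\<And>t. t \<in> {0..real T} \<Longrightarrow> \<bar>deriv \<psi> t\<bar> \<le> D"
    using compact_imp_bounded bounded_pos by (metis image_eqI real_norm_def)
  have "(\<lambda>m. \<integral>t. s m t \<partial>lborel) \<longlonglongrightarrow> (\<integral>t. indicator {0..} t *\<^sub>R (x t * deriv \<psi> t) \<partial>lborel)"
  proof (rule integral_dominated_convergence)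
    have "(\<lambda>t. (indicator {0..} t * x t) * deriv \<psi> t) \<in> borel_measurable borel"
      by (intro borel_measurable_times cadlag_borel_measurable x borel_measurable_continuous_onI
          smooth_continuous smooth_deriv \<psi>)
    then show "(\<lambda>t. indicator {0..} t *\<^sub>R (x t * deriv \<psi> t)) \<in> borel_measurable lborel"
      by (simp add: mult.assoc)
    have "deriv \<psi> \<in> borel_measurable borel"
      by (intro borel_measurable_continuous_onI smooth_continuous smooth_deriv \<psi>)
    then show "s m \<in> borel_measurable lborel" for m
      unfolding s_def by measurable
    show "integrable lborel (\<lambda>t. (B * D) * indicator {0..real T} t)" by simp
    show "AE t in lborel. (\<lambda>m. s m t) \<longlonglongrightarrow> indicator {0..} t *\<^sub>R (x t * deriv \<psi> t)"
      using AE_lborel_singleton[of "real T"]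
    proof eventually_elim
      case (elim t)
      show ?case
      proof (cases "t \<in> {0..<real T}")
        case True
        then show ?thesis unfolding s
          by (auto intro!: tendsto_mult_right cadlag_next_dyadic x)
      next
        case False
        then show ?thesis using elim d0[of t] by (auto simp: s indicator_def)
      qed
    qed
    show "AE t in lborel. norm (s m t) \<le> (B * D) * indicator {0..real T} t" for m
    proof (rule AE_I2)
      fix t
      show "norm (s m t) \<le> (B * D) * indicator {0..real T} t"
      proof (cases "t \<in> {0..<real T}")
        case True
        have "next_dyadic m t \<le> t + 1 / 2 ^ m" by (rule next_dyadic_le)
        also have "\<dots> \<le> t + 1" by simp
        finally have "next_dyadic m t \<in> {0..real T + 1}"
          using True next_dyadic_gt[of t m] by auto
        then have "\<bar>x (next_dyadic m t)\<bar> * \<bar>deriv \<psi> t\<bar> \<le> B * D"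
          using True B by (intro mult_mono B D) auto
        then show ?thesis using True by (simp add: s abs_mult)
      next
        case False
        then show ?thesis using B D by (simp add: s)
      qed
    qed
  qed
  then show ?thesis unfolding parts set_lebesgue_integral_def by (rule tendsto_minus)
qed

section \<open>Sums of independent random variables\<close>

text \<open>
  Independence of two disjoint groups of variables, for events given by predicates of the whole
  family that depend on one group only.
\<close>

lemma (in prob_space) indep_vars_prob_conj:
  fixes D :: "'i \<Rightarrow> 'a \<Rightarrow> real"
  assumes ind: "indep_vars (\<lambda>_. borel) D I" and JK: "J \<inter> K = {}" "J \<subseteq> I" "K \<subseteq> I"
    and P: "{y \<in> space (PiM J (\<lambda>_. borel)). P y} \<in> sets (PiM J (\<lambda>_. borel))"
    and Q: "{y \<in> space (PiM K (\<lambda>_. borel)). Q y} \<in> sets (PiM K (\<lambda>_. borel))"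
    and PJ: "\<And>y. P (restrict y J) = P y" and QK: "\<And>y. Q (restrict y K) = Q y"
  shows "prob {\<omega> \<in> space M. P (\<lambda>i. D i \<omega>) \<and> Q (\<lambda>i. D i \<omega>)} =
    prob {\<omega> \<in> space M. P (\<lambda>i. D i \<omega>)} * prob {\<omega> \<in> space M. Q (\<lambda>i. D i \<omega>)}"
proof -
  have sp: "restrict y J \<in> space (PiM J (\<lambda>_. borel))" for y :: "'i \<Rightarrow> real" and J
    by (simp add: space_PiM)
  have pre: "(\<lambda>\<omega>. restrict (\<lambda>i. D i \<omega>) J) -` {y \<in> space (PiM J (\<lambda>_. borel)). P y} \<inter> space M =
      {\<omega> \<in> space M. P (\<lambda>i. D i \<omega>)}"
    "(\<lambda>\<omega>. restrict (\<lambda>i. D i \<omega>) K) -` {y \<in> space (PiM K (\<lambda>_. borel)). Q y} \<inter> space M =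
      {\<omega> \<in> space M. Q (\<lambda>i. D i \<omega>)}"
    "(\<lambda>\<omega>. (restrict (\<lambda>i. D i \<omega>) J, restrict (\<lambda>i. D i \<omega>) K)) -`
        ({y \<in> space (PiM J (\<lambda>_. borel)). P y} \<times> {y \<in> space (PiM K (\<lambda>_. borel)). Q y}) \<inter> space M =
      {\<omega> \<in> space M. P (\<lambda>i. D i \<omega>) \<and> Q (\<lambda>i. D i \<omega>)}"
    by (auto simp: sp PJ QK)
  show ?thesis
    using indep_varD[OF indep_var_restrict[OF ind JK] P Q] unfolding pre .
qed

text \<open>
  Stop at the first \<open>k\<close> at which the partial sum leaves \<open>{- 2 * a..2 * a}\<close>.  The remaining
  increments are independent of this event, and with probability at least \<open>q\<close> they do not
  bring the sum back to \<open>{- a..a}\<close>.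
\<close>

lemma (in prob_space) ottaviani_inequality:
  fixes D :: "nat \<Rightarrow> 'a \<Rightarrow> real"
  assumes ind: "indep_vars (\<lambda>_. borel) D {..<N}"
    and q: "\<And>k. k \<le> N \<Longrightarrow> q \<le> prob {\<omega> \<in> space M. \<bar>\<Sum>i=k..<N. D i \<omega>\<bar> \<le> a}"
  shows "q * prob {\<omega> \<in> space M. \<exists>k\<le>N. \<bar>\<Sum>i<k. D i \<omega>\<bar> > 2 * a} \<le>
    prob {\<omega> \<in> space M. \<bar>\<Sum>i<N. D i \<omega>\<bar> > a}"
proof -
  have D: "D i \<in> borel_measurable M" if "i < N" for i
    using ind that by (auto simp: indep_vars_def)
  have S[measurable]: "(\<lambda>\<omega>. \<Sum>i\<in>I. D i \<omega>) \<in> borel_measurable M" if "I \<subseteq> {..<N}" for I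
    using that by (intro borel_measurable_sum D) auto
  \<comment> \<open>\<open>P k\<close>: the first exit is at \<open>k\<close>, a property of the increments before \<open>k\<close>;
    \<open>Q k\<close>: the later increments do not bring the sum back\<close>
  define P where "P k y \<longleftrightarrow> \<bar>\<Sum>i<k. y i\<bar> > 2 * a \<and> (\<forall>j<k. \<bar>\<Sum>i<j. y i\<bar> \<le> 2 * a)" for k and y :: "nat \<Rightarrow> real"
  define Q where "Q k y \<longleftrightarrow> \<bar>\<Sum>i=k..<N. y i\<bar> \<le> a" for k and y :: "nat \<Rightarrow> real"
  define A where "A k = {\<omega> \<in> space M. P k (\<lambda>i. D i \<omega>)}" for k
  define B where "B k = {\<omega> \<in> space M. P k (\<lambda>i. D i \<omega>) \<and> Q k (\<lambda>i. D i \<omega>)}" for k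
  have S_k: "(\<lambda>\<omega>. \<Sum>i<k. D i \<omega>) \<in> borel_measurable M" if "k \<le> N" for k
    using that by (intro S) auto
  have Q_k: "(\<lambda>\<omega>. \<Sum>i=k..<N. D i \<omega>) \<in> borel_measurable M" for k
    by (intro S) auto
  have Am: "A k \<in> events" if "k \<le> N" for k
  proof -
    have "A k = {\<omega> \<in> space M. 2 * a < \<bar>\<Sum>i<k. D i \<omega>\<bar>} \<inter>
        (space M \<inter> (\<Inter>j\<in>{..<k}. {\<omega> \<in> space M. \<bar>\<Sum>i<j. D i \<omega>\<bar> \<le> 2 * a}))"
      by (auto simp: A_def P_def)
    also have "\<dots> \<in> events"
    proof (rule sets.Int)
      show "{\<omega> \<in> space M. 2 * a < \<bar>\<Sum>i<k. D i \<omega>\<bar>} \<in> events"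
        using S_k[OF that] by (intro borel_measurable_less) auto
      show "space M \<inter> (\<Inter>j\<in>{..<k}. {\<omega> \<in> space M. \<bar>\<Sum>i<j. D i \<omega>\<bar> \<le> 2 * a}) \<in> events"
      proof (cases "k = 0")
        case False
        have "{\<omega> \<in> space M. \<bar>\<Sum>i<j. D i \<omega>\<bar> \<le> 2 * a} \<in> events" if "j \<in> {..<k}" for j
          using that \<open>k \<le> N\<close> S_k[of j] by (intro borel_measurable_le) auto
        then show ?thesis using False by (intro sets.Int sets.top sets.finite_INT) auto
      qed simp
    qed
    finally show ?thesis .
  qed
  have Qm: "{\<omega> \<in> space M. Q k (\<lambda>i. D i \<omega>)} \<in> events" for k
    unfolding Q_def using Q_k[of k] by (intro borel_measurable_le) auto
  have Bm: "B k \<in> events" if "k \<le> N" for k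
  proof -
    have "B k = A k \<inter> {\<omega> \<in> space M. Q k (\<lambda>i. D i \<omega>)}" by (auto simp: A_def B_def)
    then show ?thesis using Am[OF that] Qm by auto
  qed
  have AB: "q * prob (A k) \<le> prob (B k)" if k: "k \<le> N" for k
  proof -
    have "prob (B k) = prob (A k) * prob {\<omega> \<in> space M. Q k (\<lambda>i. D i \<omega>)}"
      unfolding A_def B_def
    proof (rule indep_vars_prob_conj[OF ind, of "{..<k}" "{k..<N}"])
      show "{y \<in> space (PiM {..<k} (\<lambda>_. borel)). P k y} \<in> sets (PiM {..<k} (\<lambda>_. borel))"
      proof -
        have c: "(\<lambda>y. \<Sum>i<j. y i) \<in> borel_measurable (PiM {..<k} (\<lambda>_. borel :: real measure))" if "j \<le> k" for j
          using that by (intro borel_measurable_sum measurable_component_singleton) auto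
        have c': "Measurable.pred (PiM {..<k} (\<lambda>_. borel :: real measure)) (\<lambda>y. \<bar>\<Sum>i<j. y i\<bar> \<le> 2 * a)" if "j < k" for j
          unfolding pred_def using c[of j] that by (intro borel_measurable_le) auto
        have "Measurable.pred (PiM {..<k} (\<lambda>_. borel :: real measure)) (\<lambda>y. \<forall>j\<in>{..<k}. \<bar>\<Sum>i<j. y i\<bar> \<le> 2 * a)"
          by (intro pred_intros_finite c') auto
        moreover have "Measurable.pred (PiM {..<k} (\<lambda>_. borel :: real measure)) (\<lambda>y. \<bar>\<Sum>i<k. y i\<bar> > 2 * a)"
          unfolding pred_def using c[of k] by (intro borel_measurable_less) auto
        ultimately have "Measurable.pred (PiM {..<k} (\<lambda>_. borel :: real measure)) (P k)"
          unfolding P_def[abs_def] by (simp add: Ball_def)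
        then show ?thesis by (rule predE)
      qed
      show "{y \<in> space (PiM {k..<N} (\<lambda>_. borel)). Q k y} \<in> sets (PiM {k..<N} (\<lambda>_. borel))"
      proof -
        have "(\<lambda>y. \<Sum>i=k..<N. y i) \<in> borel_measurable (PiM {k..<N} (\<lambda>_. borel :: real measure))"
          by (intro borel_measurable_sum measurable_component_singleton)
        then show ?thesis unfolding Q_def by (intro borel_measurable_le) auto
      qed
      have "(\<Sum>i<j. restrict y {..<k} i) = (\<Sum>i<j. y i)" if "j \<le> k" for j and y :: "nat \<Rightarrow> real"
        using that by (intro sum.cong) auto
      then show "P k (restrict y {..<k}) = P k y" for y
        by (simp add: P_def)
      have "(\<Sum>i=k..<N. restrict y {k..<N} i) = (\<Sum>i=k..<N. y i)" for y :: "nat \<Rightarrow> real"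
        by (intro sum.cong) auto
      then show "Q k (restrict y {k..<N}) = Q k y" for y
        by (simp add: Q_def)
    qed (use k in auto)
    moreover have "q * prob (A k) \<le> prob {\<omega> \<in> space M. Q k (\<lambda>i. D i \<omega>)} * prob (A k)"
      unfolding Q_def by (intro mult_right_mono q k) auto
    ultimately show ?thesis by (simp add: mult.commute)
  qed
  have disj: "disjoint_family_on B {..N}" "disjoint_family_on A {..N}"
    unfolding disjoint_family_on_def A_def B_def P_def
    by (auto, (metis linorder_neqE_nat not_le)+)
  have "prob {\<omega> \<in> space M. \<exists>k\<le>N. \<bar>\<Sum>i<k. D i \<omega>\<bar> > 2 * a} = prob (\<Union>k\<in>{..N}. A k)"
  proof (rule arg_cong[where f=prob], intro equalityI subsetI)
    fix \<omega> assume "\<omega> \<in> {\<omega> \<in> space M. \<exists>k\<le>N. \<bar>\<Sum>i<k. D i \<omega>\<bar> > 2 * a}"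
    then obtain k where k: "\<omega> \<in> space M" "k \<le> N" "\<bar>\<Sum>i<k. D i \<omega>\<bar> > 2 * a" by blast
    define k0 where "k0 = (LEAST k. \<bar>\<Sum>i<k. D i \<omega>\<bar> > 2 * a)"
    have "\<bar>\<Sum>i<k0. D i \<omega>\<bar> > 2 * a" unfolding k0_def using k(3) by (rule LeastI)
    moreover have "k0 \<le> k" unfolding k0_def using k(3) by (rule Least_le)
    then have "k0 \<le> N" using k(2) by simp
    moreover have "\<bar>\<Sum>i<j. D i \<omega>\<bar> \<le> 2 * a" if "j < k0" for j
      using not_less_Least[OF that[unfolded k0_def]] by simp
    ultimately show "\<omega> \<in> (\<Union>k\<in>{..N}. A k)" using k(1) by (auto simp: A_def P_def)
  qed (auto simp: A_def P_def)
  also have "\<dots> = (\<Sum>k\<le>N. prob (A k))"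
    using disj(2) by (intro finite_measure_finite_Union) (auto intro: Am)
  finally have "q * prob {\<omega> \<in> space M. \<exists>k\<le>N. \<bar>\<Sum>i<k. D i \<omega>\<bar> > 2 * a} = (\<Sum>k\<le>N. q * prob (A k))"
    by (simp add: sum_distrib_left)
  also have "\<dots> \<le> (\<Sum>k\<le>N. prob (B k))" by (intro sum_mono AB) auto
  also have "\<dots> = prob (\<Union>k\<in>{..N}. B k)"
    using disj(1) by (intro finite_measure_finite_Union[symmetric]) (auto intro: Bm)
  also have "\<dots> \<le> prob {\<omega> \<in> space M. \<bar>\<Sum>i<N. D i \<omega>\<bar> > a}"
  proof (rule finite_measure_mono)
    show "(\<Union>k\<in>{..N}. B k) \<subseteq> {\<omega> \<in> space M. \<bar>\<Sum>i<N. D i \<omega>\<bar> > a}"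
    proof
      fix \<omega> assume "\<omega> \<in> (\<Union>k\<in>{..N}. B k)"
      then obtain k where k: "k \<le> N" "\<omega> \<in> space M" "\<bar>\<Sum>i<k. D i \<omega>\<bar> > 2 * a" "\<bar>\<Sum>i=k..<N. D i \<omega>\<bar> \<le> a"
        by (auto simp: B_def P_def Q_def)
      have "(\<Sum>i<N. D i \<omega>) = (\<Sum>i<k. D i \<omega>) + (\<Sum>i=k..<N. D i \<omega>)"
        using sum.atLeastLessThan_concat[of 0 k N "\<lambda>i. D i \<omega>"] k(1) by (simp add: atLeast0LessThan)
      then show "\<omega> \<in> {\<omega> \<in> space M. \<bar>\<Sum>i<N. D i \<omega>\<bar> > a}" using k by auto
    qed
    show "{\<omega> \<in> space M. \<bar>\<Sum>i<N. D i \<omega>\<bar> > a} \<in> events"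
      using S_k[of N] by (intro borel_measurable_less) auto
  qed
  finally show ?thesis .
qed

section \<open>Increments of Levy processes\<close>

lemma levy_measurable: "levy_process M X \<Longrightarrow> t \<ge> 0 \<Longrightarrow> X t \<in> borel_measurable M"
  by (simp add: levy_process_def)

lemma levy_cadlag: "levy_process M X \<Longrightarrow> \<omega> \<in> space M \<Longrightarrow> cadlag (\<lambda>t. X t \<omega>)"
  by (simp add: levy_process_def)

lemma levy_dyadic_measurable:
  assumes "levy_process M X"
  shows "X (real n + real i / 2 ^ m) \<in> borel_measurable M"
    and "X (real n) \<in> borel_measurable M"
  by (auto intro!: levy_measurable[OF assms])

lemma (in prob_space) levy_indep_increments:
  assumes L: "levy_process M X"
  shows "indep_vars (\<lambda>_. borel)
    (\<lambda>i \<omega>. X (real n + real (Suc i) / 2 ^ m) \<omega> - X (real n + real i / 2 ^ m) \<omega>) {..<N}"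
proof -
  have *: "indep_vars (\<lambda>_. borel) (\<lambda>i \<omega>. X (t (Suc i)) \<omega> - X (t i) \<omega>) {..<N}"
    if "0 \<le> t 0" "\<And>i. t i \<le> t (Suc i)" for t :: "nat \<Rightarrow> real"
    using L that unfolding levy_process_def by blast
  show ?thesis
    by (rule *[of "\<lambda>i. real n + real i / 2 ^ m"]) (auto simp: divide_right_mono)
qed

lemma (in prob_space) levy_stationary_increments:
  assumes L: "levy_process M X" and "s \<ge> 0" "h \<ge> 0" and A: "{x. P x} \<in> sets borel"
  shows "prob {\<omega> \<in> space M. P (X (s + h) \<omega> - X s \<omega>)} = prob {\<omega> \<in> space M. P (X h \<omega> - X 0 \<omega>)}"
proof -
  have m: "(\<lambda>\<omega>. X t \<omega> - X u \<omega>) \<in> borel_measurable M" if "t \<ge> 0" "u \<ge> 0" for t u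
    using that by (intro borel_measurable_diff levy_measurable[OF L])
  have "measure (distr M borel (\<lambda>\<omega>. X (s + h) \<omega> - X s \<omega>)) {x. P x} =
      measure (distr M borel (\<lambda>\<omega>. X h \<omega> - X 0 \<omega>)) {x. P x}"
    using assms unfolding levy_process_def by metis
  then show ?thesis
    using assms(2,3) by (simp add: measure_distr m A vimage_def Int_def conj_commute)
qed

text \<open>
  Tightness over a compact time interval comes for free from the paths, each of which is
  bounded there: the events that the path exceeds \<open>n\<close> at some rational time decrease to the
  empty set.
\<close>

lemma (in prob_space) levy_tight:
  assumes L: "levy_process M X" and e: "e > 0"
  shows "\<exists>a0\<ge>0. \<forall>a\<ge>a0. \<forall>s\<in>{0..T}. prob {\<omega> \<in> space M. \<bar>X s \<omega> - X 0 \<omega>\<bar> \<le> a} \<ge> 1 - e"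
proof -
  \<comment> \<open>up to \<open>T + 1\<close>, because the dyadic approximations of \<open>s \<le> T\<close> lie to the right of \<open>s\<close>\<close>
  define Q where "Q = \<rat> \<inter> {0..T + 1}"
  have Q: "countable Q" unfolding Q_def by (intro countable_Int1 countable_rat)
  define E where "E n = (\<Union>t\<in>Q. {\<omega> \<in> space M. \<bar>X t \<omega> - X 0 \<omega>\<bar> > real n})" for n
  have m: "(\<lambda>\<omega>. \<bar>X t \<omega> - X 0 \<omega>\<bar>) \<in> borel_measurable M" if "t \<ge> 0" for t
    using that by (intro borel_measurable_abs borel_measurable_diff levy_measurable[OF L]) auto
  have E: "E n \<in> events" for n
    unfolding E_def by (rule sets.countable_UN'[OF Q])
      (auto simp: Q_def intro!: borel_measurable_less m)
  have "(\<Inter>n. E n) = {}"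
  proof (rule equals0I)
    fix \<omega> assume \<omega>: "\<omega> \<in> (\<Inter>n. E n)"
    then have "\<omega> \<in> space M" by (auto simp: E_def)
    then obtain B where B: "\<And>t. t \<in> {0..T + 1} \<Longrightarrow> \<bar>X t \<omega>\<bar> \<le> B"
      using cadlag_bounded[OF levy_cadlag[OF L]] by blast
    obtain n where n: "2 * B \<le> real n" using real_arch_simple by blast
    have "\<omega> \<in> E n" using \<omega> by blast
    then obtain t where t: "t \<in> {0..T + 1}" "\<bar>X t \<omega> - X 0 \<omega>\<bar> > real n" by (auto simp: E_def Q_def)
    have "0 \<in> {0..T + 1}" using t by auto
    then show False using B[of t] B[of 0] t n by linarith
  qed
  moreover have "(\<lambda>n. prob (E n)) \<longlonglongrightarrow> prob (\<Inter>n. E n)"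
  proof (rule finite_Lim_measure_decseq)
    show "decseq E"
    proof (rule decseq_SucI)
      show "E (Suc n) \<subseteq> E n" for n unfolding E_def by force
    qed
  qed (use E in auto)
  ultimately have "(\<lambda>n. prob (E n)) \<longlonglongrightarrow> 0" by simp
  then have "eventually (\<lambda>n. prob (E n) < e) sequentially" using e by (rule order_tendstoD)
  then obtain n where n: "prob (E n) < e" using eventually_sequentially by auto
  have "prob {\<omega> \<in> space M. \<bar>X s \<omega> - X 0 \<omega>\<bar> \<le> a} \<ge> 1 - e" if a: "a \<ge> real n" and s: "s \<in> {0..T}" for a s
  proof -
    have "space M - E n \<subseteq> {\<omega> \<in> space M. \<bar>X s \<omega> - X 0 \<omega>\<bar> \<le> a}"
    proof safe
      fix \<omega> assume \<omega>: "\<omega> \<in> space M" "\<omega> \<notin> E n"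
      have "\<bar>X (next_dyadic m s) \<omega> - X 0 \<omega>\<bar> \<le> real n" for m
      proof -
        have "next_dyadic m s \<le> s + 1 / 2 ^ m" by (rule next_dyadic_le)
        also have "\<dots> \<le> s + 1" by simp
        finally have "next_dyadic m s \<in> {0..T + 1}" using s next_dyadic_gt[of s m] by auto
        moreover have "next_dyadic m s \<in> \<rat>" by (simp add: next_dyadic_def)
        ultimately show ?thesis using \<omega> by (force simp: E_def Q_def)
      qed
      moreover have "(\<lambda>m. \<bar>X (next_dyadic m s) \<omega> - X 0 \<omega>\<bar>) \<longlonglongrightarrow> \<bar>X s \<omega> - X 0 \<omega>\<bar>"
        using s by (intro tendsto_intros cadlag_next_dyadic levy_cadlag[OF L \<omega>(1)]) auto
      ultimately have "\<bar>X s \<omega> - X 0 \<omega>\<bar> \<le> real n" by (intro LIMSEQ_le_const2) auto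
      then show "\<bar>X s \<omega> - X 0 \<omega>\<bar> \<le> a" using a by simp
    qed
    then have "prob (space M - E n) \<le> prob {\<omega> \<in> space M. \<bar>X s \<omega> - X 0 \<omega>\<bar> \<le> a}"
      using s m[of s] by (intro finite_measure_mono borel_measurable_le) auto
    then show ?thesis using n prob_compl[OF E[of n]] by linarith
  qed
  then show ?thesis by (intro exI[of _ "real n"]) auto
qed

text \<open>
  The bound is uniform in the starting point and in the mesh: both probabilities occurring in
  Ottaviani's inequality depend on lengths of time intervals only.
\<close>

lemma (in prob_space) levy_maximal_inequality:
  assumes L: "levy_process M X"
  shows "\<exists>a0\<ge>0. \<forall>a\<ge>a0. \<forall>n m.
    prob {\<omega> \<in> space M. \<exists>k\<le>T * 2 ^ m. \<bar>X (real n + real k / 2 ^ m) \<omega> - X (real n) \<omega>\<bar> > 2 * a} \<le>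
    2 * prob {\<omega> \<in> space M. \<bar>X (real T) \<omega> - X 0 \<omega>\<bar> > a}"
proof -
  obtain a0 where a0: "a0 \<ge> 0" "\<And>a s. a \<ge> a0 \<Longrightarrow> s \<in> {0..real T} \<Longrightarrow>
      prob {\<omega> \<in> space M. \<bar>X s \<omega> - X 0 \<omega>\<bar> \<le> a} \<ge> 1 - 1 / 2"
    using levy_tight[OF L, of "1 / 2" "real T"] by auto
  have "prob {\<omega> \<in> space M. \<exists>k\<le>T * 2 ^ m. \<bar>X (real n + real k / 2 ^ m) \<omega> - X (real n) \<omega>\<bar> > 2 * a} \<le>
      2 * prob {\<omega> \<in> space M. \<bar>X (real T) \<omega> - X 0 \<omega>\<bar> > a}" if a: "a \<ge> a0" for a n m
  proof -
    let ?x = "\<lambda>\<omega> i. X (real n + real i / 2 ^ m) \<omega>"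
    let ?N = "T * 2 ^ m"
    have tele: "(\<Sum>i=k..<N. ?x \<omega> (Suc i) - ?x \<omega> i) = ?x \<omega> N - ?x \<omega> k" if "k \<le> N" for k N \<omega>
      using sum_Suc_diff'[OF that, of "?x \<omega>"] .
    have tele0: "(\<Sum>i<k. ?x \<omega> (Suc i) - ?x \<omega> i) = ?x \<omega> k - X (real n) \<omega>" for k \<omega>
      using tele[of 0 k \<omega>] by (simp add: atLeast0LessThan)
    have "1 / 2 * prob {\<omega> \<in> space M. \<exists>k\<le>?N. \<bar>\<Sum>i<k. ?x \<omega> (Suc i) - ?x \<omega> i\<bar> > 2 * a} \<le>
        prob {\<omega> \<in> space M. \<bar>\<Sum>i<?N. ?x \<omega> (Suc i) - ?x \<omega> i\<bar> > a}"
    proof (rule ottaviani_inequality[OF levy_indep_increments[OF L]])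
      fix k assume k: "k \<le> ?N"
      define h where "h = real T - real k / 2 ^ m"
      have "real k \<le> real T * 2 ^ m" using k by (metis of_nat_le_iff of_nat_mult of_nat_numeral of_nat_power)
      then have h: "0 \<le> h" "h \<le> real T" by (simp_all add: h_def divide_le_eq)
      have "1 / 2 \<le> prob {\<omega> \<in> space M. \<bar>X h \<omega> - X 0 \<omega>\<bar> \<le> a}"
        using a0(2)[OF a, of h] h by simp
      also have "\<dots> = prob {\<omega> \<in> space M. \<bar>X ((real n + real k / 2 ^ m) + h) \<omega> - X (real n + real k / 2 ^ m) \<omega>\<bar> \<le> a}"
        by (rule levy_stationary_increments[OF L, symmetric]) (use h in auto)
      also have "(real n + real k / 2 ^ m) + h = real n + real ?N / 2 ^ m" by (simp add: h_def)
      finally show "1 / 2 \<le> prob {\<omega> \<in> space M. \<bar>\<Sum>i=k..<?N. ?x \<omega> (Suc i) - ?x \<omega> i\<bar> \<le> a}"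
        unfolding tele[OF k] .
    qed
    also have "prob {\<omega> \<in> space M. \<bar>\<Sum>i<?N. ?x \<omega> (Suc i) - ?x \<omega> i\<bar> > a} =
        prob {\<omega> \<in> space M. \<bar>X (real n + real T) \<omega> - X (real n) \<omega>\<bar> > a}"
      unfolding tele0 by simp
    also have "\<dots> = prob {\<omega> \<in> space M. \<bar>X (real T) \<omega> - X 0 \<omega>\<bar> > a}"
      by (rule levy_stationary_increments[OF L]) auto
    finally show ?thesis unfolding tele0 by simp
  qed
  then show ?thesis using a0(1) by blast
qed

section \<open>Moments and tail sums\<close>

text \<open>
  The number of integers in \<open>{1..<y}\<close> differs from \<open>y\<close> by at most one; taking expectations
  compares a first moment with its tail sum.
\<close>

lemma suminf_indicator_bounds:
  fixes y :: real
  assumes "y \<ge> 0"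
  shows "(\<Sum>n. indicator {n. real n + 1 < y} n :: ennreal) \<le> ennreal y"
    and "ennreal y \<le> 1 + (\<Sum>n. indicator {n. real n + 1 < y} n)"
proof -
  define k where "k = nat \<lceil>y\<rceil> - 1"
  have k: "real n + 1 < y \<longleftrightarrow> n < k" for n
  proof -
    have "real n + 1 < y \<longleftrightarrow> int n + 1 < \<lceil>y\<rceil>"
      by (simp add: less_ceiling_iff)
    then show ?thesis by (auto simp: k_def)
  qed
  have "(\<Sum>n. indicator {n. real n + 1 < y} n :: ennreal) = (\<Sum>n<k. indicator {n. real n + 1 < y} n)"
    by (rule suminf_finite) (auto simp: k)
  also have "\<dots> = (\<Sum>n<k. 1)"
    by (rule sum.cong) (auto simp: k)
  also have "\<dots> = ennreal (real k)" by (simp add: ennreal_of_nat_eq_real_of_nat)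
  finally have sum: "(\<Sum>n. indicator {n. real n + 1 < y} n :: ennreal) = ennreal (real k)" .
  have "real k \<le> y" using assms unfolding k_def by linarith
  then show "(\<Sum>n. indicator {n. real n + 1 < y} n :: ennreal) \<le> ennreal y"
    unfolding sum by (rule ennreal_leI)
  have "y \<le> 1 + real k" unfolding k_def by linarith
  then have "ennreal y \<le> ennreal (1 + real k)" by (rule ennreal_leI)
  then show "ennreal y \<le> 1 + (\<Sum>n. indicator {n. real n + 1 < y} n)"
    unfolding sum by (simp add: ennreal_plus)
qed

lemma (in prob_space)
  fixes Y :: "'a \<Rightarrow> real"
  assumes [measurable]: "Y \<in> borel_measurable M" and nonneg: "\<And>\<omega>. Y \<omega> \<ge> 0"
  shows tail_sum_le_nn_integral:
      "(\<Sum>n. emeasure M {\<omega> \<in> space M. Y \<omega> > real n + 1}) \<le> (\<integral>\<^sup>+\<omega>. ennreal (Y \<omega>) \<partial>M)"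
    and nn_integral_le_tail_sum:
      "(\<integral>\<^sup>+\<omega>. ennreal (Y \<omega>) \<partial>M) \<le> 1 + (\<Sum>n. emeasure M {\<omega> \<in> space M. Y \<omega> > real n + 1})"
proof -
  have "(\<Sum>n. emeasure M {\<omega> \<in> space M. Y \<omega> > real n + 1}) =
      (\<Sum>n. \<integral>\<^sup>+\<omega>. indicator {\<omega> \<in> space M. Y \<omega> > real n + 1} \<omega> \<partial>M)"
    by (intro suminf_cong nn_integral_indicator[symmetric]) measurable
  also have "\<dots> = (\<integral>\<^sup>+\<omega>. (\<Sum>n. indicator {\<omega> \<in> space M. Y \<omega> > real n + 1} \<omega>) \<partial>M)"
    by (intro nn_integral_suminf[symmetric]) measurable
  also have "\<dots> = (\<integral>\<^sup>+\<omega>. (\<Sum>n. indicator {n. real n + 1 < Y \<omega>} n) \<partial>M)"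
    by (intro nn_integral_cong suminf_cong) (auto simp: indicator_def)
  finally have sum: "(\<Sum>n. emeasure M {\<omega> \<in> space M. Y \<omega> > real n + 1}) =
      (\<integral>\<^sup>+\<omega>. (\<Sum>n. indicator {n. real n + 1 < Y \<omega>} n) \<partial>M)" .
  show "(\<Sum>n. emeasure M {\<omega> \<in> space M. Y \<omega> > real n + 1}) \<le> (\<integral>\<^sup>+\<omega>. ennreal (Y \<omega>) \<partial>M)"
    unfolding sum by (intro nn_integral_mono suminf_indicator_bounds nonneg)
  have "(\<integral>\<^sup>+\<omega>. ennreal (Y \<omega>) \<partial>M) \<le> (\<integral>\<^sup>+\<omega>. 1 + (\<Sum>n. indicator {n. real n + 1 < Y \<omega>} n) \<partial>M)"
    by (intro nn_integral_mono suminf_indicator_bounds nonneg)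
  also have "\<dots> = 1 + (\<integral>\<^sup>+\<omega>. (\<Sum>n. indicator {n. real n + 1 < Y \<omega>} n) \<partial>M)"
    by (subst nn_integral_add) (auto simp: emeasure_space_1 indicator_def)
  finally show "(\<integral>\<^sup>+\<omega>. ennreal (Y \<omega>) \<partial>M) \<le> 1 + (\<Sum>n. emeasure M {\<omega> \<in> space M. Y \<omega> > real n + 1})"
    unfolding sum .
qed

lemma (in prob_space) summable_tail_if_moment:
  fixes Z :: "'a \<Rightarrow> real"
  assumes Z[measurable]: "Z \<in> borel_measurable M" and \<eta>: "\<eta> > 0"
    and fin: "(\<integral>\<^sup>+\<omega>. ennreal (\<bar>Z \<omega>\<bar> powr \<eta>) \<partial>M) < \<infinity>"
  shows "\<exists>p\<ge>1::nat. summable (\<lambda>n. prob {\<omega> \<in> space M. \<bar>Z \<omega>\<bar> > (real n + 1) ^ p})"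
proof -
  \<comment> \<open>then \<open>p * \<eta> \<ge> 1\<close>, so \<open>\<bar>Z\<bar> > (n + 1) ^ p\<close> forces \<open>\<bar>Z\<bar> powr \<eta> > n + 1\<close>\<close>
  define p where "p = nat \<lceil>1 / \<eta>\<rceil> + 1"
  have "1 / \<eta> \<le> real p" unfolding p_def by linarith
  then have p: "1 \<le> real p * \<eta>" using \<eta> by (simp add: field_simps)
  have le: "prob {\<omega> \<in> space M. \<bar>Z \<omega>\<bar> > (real n + 1) ^ p} \<le>
      prob {\<omega> \<in> space M. \<bar>Z \<omega>\<bar> powr \<eta> > real n + 1}" for n
  proof (rule finite_measure_mono)
    show "{\<omega> \<in> space M. \<bar>Z \<omega>\<bar> > (real n + 1) ^ p} \<subseteq> {\<omega> \<in> space M. \<bar>Z \<omega>\<bar> powr \<eta> > real n + 1}"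
    proof safe
      fix \<omega> assume Z: "\<bar>Z \<omega>\<bar> > (real n + 1) ^ p"
      have "real n + 1 \<le> (real n + 1) powr (real p * \<eta>)"
        using powr_mono[OF p, of "real n + 1"] by simp
      also have "\<dots> = ((real n + 1) ^ p) powr \<eta>"
        by (simp add: powr_powr[symmetric] powr_realpow)
      also have "\<dots> < \<bar>Z \<omega>\<bar> powr \<eta>"
        using Z \<eta> by (intro powr_less_mono2) auto
      finally show "\<bar>Z \<omega>\<bar> powr \<eta> > real n + 1" .
    qed
  qed measurable
  have "(\<Sum>n. ennreal (prob {\<omega> \<in> space M. \<bar>Z \<omega>\<bar> > (real n + 1) ^ p})) \<le>
      (\<Sum>n. emeasure M {\<omega> \<in> space M. \<bar>Z \<omega>\<bar> powr \<eta> > real n + 1})"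
    by (intro suminf_le) (auto simp: emeasure_eq_measure intro: ennreal_leI le)
  also have "\<dots> \<le> (\<integral>\<^sup>+\<omega>. ennreal (\<bar>Z \<omega>\<bar> powr \<eta>) \<partial>M)"
    by (intro tail_sum_le_nn_integral) auto
  also note fin
  finally have "summable (\<lambda>n. prob {\<omega> \<in> space M. \<bar>Z \<omega>\<bar> > (real n + 1) ^ p})"
    by (intro summable_suminf_not_top) auto
  moreover have "p \<ge> 1" by (simp add: p_def)
  ultimately show ?thesis by blast
qed

lemma (in prob_space) moment_if_summable_tail:
  fixes Z :: "'a \<Rightarrow> real"
  assumes Z[measurable]: "Z \<in> borel_measurable M" and b: "b > 0" and q: "q > 0"
    and sm: "summable (\<lambda>n. prob {\<omega> \<in> space M. \<bar>Z \<omega>\<bar> > b * (real n + 1) ^ q})"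
  shows "(\<integral>\<^sup>+\<omega>. ennreal (\<bar>Z \<omega>\<bar> powr (1 / real q)) \<partial>M) < \<infinity>"
proof -
  \<comment> \<open>scaled so that \<open>Y > n + 1\<close> is the event \<open>\<bar>Z\<bar> > b * (n + 1) ^ q\<close>\<close>
  define Y where "Y \<omega> = (\<bar>Z \<omega>\<bar> / b) powr (1 / real q)" for \<omega>
  have [measurable]: "Y \<in> borel_measurable M" unfolding Y_def by measurable
  have le: "prob {\<omega> \<in> space M. Y \<omega> > real n + 1} \<le>
      prob {\<omega> \<in> space M. \<bar>Z \<omega>\<bar> > b * (real n + 1) ^ q}" for n
  proof (rule finite_measure_mono)
    show "{\<omega> \<in> space M. Y \<omega> > real n + 1} \<subseteq> {\<omega> \<in> space M. \<bar>Z \<omega>\<bar> > b * (real n + 1) ^ q}"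
    proof safe
      fix \<omega> assume Y: "real n + 1 < Y \<omega>"
      have "(real n + 1) ^ q = (real n + 1) powr real q" by (simp add: powr_realpow)
      also have "\<dots> < Y \<omega> powr real q" using Y q by (intro powr_less_mono2) auto
      also have "\<dots> = \<bar>Z \<omega>\<bar> / b" using q b by (simp add: Y_def powr_powr)
      finally show "b * (real n + 1) ^ q < \<bar>Z \<omega>\<bar>" using b by (simp add: field_simps)
    qed
  qed measurable
  have "(\<integral>\<^sup>+\<omega>. ennreal (Y \<omega>) \<partial>M) \<le> 1 + (\<Sum>n. emeasure M {\<omega> \<in> space M. Y \<omega> > real n + 1})"
    by (intro nn_integral_le_tail_sum) (auto simp: Y_def)
  also have "\<dots> \<le> 1 + (\<Sum>n. ennreal (prob {\<omega> \<in> space M. \<bar>Z \<omega>\<bar> > b * (real n + 1) ^ q}))"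
    by (intro add_mono suminf_le) (auto simp: emeasure_eq_measure intro: ennreal_leI le)
  also have "\<dots> < \<infinity>" using sm by (simp add: suminf_ennreal2)
  finally have fin: "(\<integral>\<^sup>+\<omega>. ennreal (Y \<omega>) \<partial>M) < \<infinity>" .
  have "\<bar>Z \<omega>\<bar> powr (1 / real q) = b powr (1 / real q) * Y \<omega>" for \<omega>
    using b by (simp add: Y_def powr_divide)
  then have "(\<integral>\<^sup>+\<omega>. ennreal (\<bar>Z \<omega>\<bar> powr (1 / real q)) \<partial>M) =
      (\<integral>\<^sup>+\<omega>. ennreal (b powr (1 / real q)) * ennreal (Y \<omega>) \<partial>M)"
    by (simp add: ennreal_mult' Y_def)
  also have "\<dots> = ennreal (b powr (1 / real q)) * (\<integral>\<^sup>+\<omega>. ennreal (Y \<omega>) \<partial>M)"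
    by (intro nn_integral_cmult) measurable
  also have "\<dots> < \<infinity>" using fin by (simp add: ennreal_mult_less_top)
  finally show ?thesis .
qed

section \<open>Polynomial growth of the paths\<close>

text \<open>
  Borel--Cantelli, applied to the oscillations over the unit intervals; their tails are
  controlled by the maximal inequality with the threshold \<open>a = (n + 1) ^ p\<close>, which is large
  enough from some \<open>n\<close> on.
\<close>

lemma (in prob_space) levy_poly_growth_AE:
  assumes L: "levy_process M X" and p: "p \<ge> 1"
    and sm: "summable (\<lambda>n. prob {\<omega> \<in> space M. \<bar>X 1 \<omega> - X 0 \<omega>\<bar> > (real n + 1) ^ p})"
  shows "AE \<omega> in M. \<exists>C. \<forall>t\<ge>0. \<bar>X t \<omega>\<bar> \<le> C * (1 + t) ^ Suc p"
proof -
  obtain a0 where a0: "\<And>a n m. a \<ge> a0 \<Longrightarrow>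
    prob {\<omega> \<in> space M. \<exists>k\<le>2 ^ m. \<bar>X (real n + real k / 2 ^ m) \<omega> - X (real n) \<omega>\<bar> > 2 * a} \<le>
    2 * prob {\<omega> \<in> space M. \<bar>X 1 \<omega> - X 0 \<omega>\<bar> > a}"
    using levy_maximal_inequality[OF L, of 1] by auto
  define B where "B n m = {\<omega> \<in> space M. \<exists>k\<le>2 ^ m.
    \<bar>X (real n + real k / 2 ^ m) \<omega> - X (real n) \<omega>\<bar> > 2 * (real n + 1) ^ p}" for n m :: nat
  define A where "A n = (\<Union>m. B n m)" for n
  have B: "B n m \<in> events" for n m
  proof -
    have [measurable]: "X (real n + real k / 2 ^ m) \<in> borel_measurable M" "X (real n) \<in> borel_measurable M" for k
      by (rule levy_dyadic_measurable[OF L])+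
    have "B n m = (\<Union>k\<in>{..2 ^ m}. {\<omega> \<in> space M.
        \<bar>X (real n + real k / 2 ^ m) \<omega> - X (real n) \<omega>\<bar> > 2 * (real n + 1) ^ p})"
      by (auto simp: B_def)
    also have "\<dots> \<in> events" by (rule sets.finite_UN) measurable
    finally show ?thesis .
  qed
  have A: "A n \<in> events" for n unfolding A_def using B by blast
  have "incseq (B n)" for n
  proof (rule incseq_SucI, rule subsetI)
    fix m \<omega> assume "\<omega> \<in> B n m"
    then obtain k where k: "\<omega> \<in> space M" "k \<le> 2 ^ m"
      "\<bar>X (real n + real k / 2 ^ m) \<omega> - X (real n) \<omega>\<bar> > 2 * (real n + 1) ^ p" by (auto simp: B_def)
    have "real (2 * k) / 2 ^ Suc m = real k / 2 ^ m" by simp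
    then show "\<omega> \<in> B n (Suc m)" using k unfolding B_def
      by (intro CollectI conjI exI[of _ "2 * k"]) (simp_all only:, simp)
  qed
  then have lim: "(\<lambda>m. prob (B n m)) \<longlonglongrightarrow> prob (A n)" for n
    unfolding A_def using B by (intro finite_Lim_measure_incseq) auto
  have "prob (A n) \<le> 2 * prob {\<omega> \<in> space M. \<bar>X 1 \<omega> - X 0 \<omega>\<bar> > (real n + 1) ^ p}"
    if n: "real n \<ge> a0" for n
  proof (rule LIMSEQ_le_const2[OF lim], intro exI allI impI)
    have "real n + 1 \<le> (real n + 1) ^ p" using p by (intro self_le_power) auto
    then have "(real n + 1) ^ p \<ge> a0" using n by linarith
    from a0[OF this] show "prob (B n m) \<le> 2 * prob {\<omega> \<in> space M. \<bar>X 1 \<omega> - X 0 \<omega>\<bar> > (real n + 1) ^ p}" for m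
      unfolding B_def .
  qed
  moreover have "eventually (\<lambda>n. real n \<ge> a0) sequentially"
    using filterlim_real_sequentially by (simp add: filterlim_at_top)
  ultimately have ev: "eventually (\<lambda>n. norm (prob (A n)) \<le>
      2 * prob {\<omega> \<in> space M. \<bar>X 1 \<omega> - X 0 \<omega>\<bar> > (real n + 1) ^ p}) sequentially"
    by (auto elim!: eventually_mono)
  have "summable (\<lambda>n. prob (A n))"
    by (rule summable_comparison_test_ev[OF ev summable_mult[OF sm]])
  then have "AE \<omega> in M. eventually (\<lambda>n. \<omega> \<in> space M - A n) sequentially"
    using A by (intro borel_cantelli_AE1) (auto simp: emeasure_eq_measure)
  then show ?thesis
    using AE_space
  proof eventually_elim
    case (elim \<omega>)
    then obtain n0 where n0: "\<And>n. n \<ge> n0 \<Longrightarrow> \<omega> \<notin> A n" by (auto simp: eventually_sequentially)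
    have c: "cadlag (\<lambda>t. X t \<omega>)" using levy_cadlag[OF L elim(2)] .
    show ?case
    proof (rule cadlag_poly_growth[OF c])
      fix n t assume n: "n \<ge> n0" and t: "real n \<le> t" "t \<le> real n + 1"
      show "\<bar>X t \<omega> - X (real n) \<omega>\<bar> \<le> 2 * (real n + 1) ^ p"
      proof (rule cadlag_unit_increment_le[OF c _ t])
        fix m i :: nat assume "i \<le> 2 ^ m"
        then show "\<bar>X (real n + real i / 2 ^ m) \<omega> - X (real n) \<omega>\<bar> \<le> 2 * (real n + 1) ^ p"
          using n0[OF n] elim(2) by (auto simp: A_def B_def not_less[symmetric])
      qed
    qed
  qed
qed

section \<open>White noise on translates of the plateau\<close>

text \<open>
  The pathwise integral of the plateau, translated by \<open>3 * n\<close>, against \<open>X\<close>, with mesh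
  \<open>1 / 2 ^ m\<close>.  The increments are those of the path, so that independence is visible before
  the limit is taken.
\<close>

definition dyadic_noise :: "(real \<Rightarrow> 'a \<Rightarrow> real) \<Rightarrow> nat \<Rightarrow> nat \<Rightarrow> 'a \<Rightarrow> real" where
  "dyadic_noise X m n \<omega> = (\<Sum>i<3 * 2 ^ m. plateau (real i / 2 ^ m) *
    (X (real (3 * n) + real (Suc i) / 2 ^ m) \<omega> - X (real (3 * n) + real i / 2 ^ m) \<omega>))"

lemma sum_lessThan_add:
  fixes f :: "nat \<Rightarrow> real"
  shows "(\<Sum>i<a + b. f i) = (\<Sum>i<a. f i) + (\<Sum>i<b. f (a + i))"
  by (induction b) auto

lemma dyadic_noise_tendsto:
  assumes L: "levy_process M X" and \<omega>: "\<omega> \<in> space M"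
  shows "(\<lambda>m. dyadic_noise X m n \<omega>) \<longlonglongrightarrow> levy_white_noise X \<omega> (\<lambda>x. plateau (x - 3 * real n))"
proof -
  let ?\<psi> = "\<lambda>x. plateau (x - 3 * real n)"
  have "(\<lambda>m. \<Sum>i<(3 * n + 3) * 2 ^ m. ?\<psi> (real i / 2 ^ m) * (X (real (Suc i) / 2 ^ m) \<omega> - X (real i / 2 ^ m) \<omega>))
      \<longlonglongrightarrow> - (LBINT t:{0..}. X t \<omega> * deriv ?\<psi> t)"
    by (rule white_noise_dyadic_limit[OF levy_cadlag[OF L \<omega>]])
      (use plateau_translate_test_function plateau_eq_0 in \<open>auto simp: test_functions_def\<close>)
  moreover have "(\<Sum>i<(3 * n + 3) * 2 ^ m. ?\<psi> (real i / 2 ^ m) * (X (real (Suc i) / 2 ^ m) \<omega> - X (real i / 2 ^ m) \<omega>)) =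
      dyadic_noise X m n \<omega>" for m
  proof -
    have sh: "real (3 * n * 2 ^ m + i) / 2 ^ m = real (3 * n) + real i / 2 ^ m" for i
      by (simp add: field_simps)
    have z: "?\<psi> (real i / 2 ^ m) = 0" if "i < 3 * n * 2 ^ m" for i
    proof (rule plateau_eq_0, rule disjI1)
      have "real i \<le> real (3 * n * 2 ^ m)" using that by (simp only: of_nat_le_iff)
      then show "real i / 2 ^ m - 3 * real n \<le> 0" by (simp add: divide_le_eq)
    qed
    have "(\<Sum>i<3 * n * 2 ^ m. ?\<psi> (real i / 2 ^ m) * (X (real (Suc i) / 2 ^ m) \<omega> - X (real i / 2 ^ m) \<omega>)) = 0"
      by (intro sum.neutral ballI) (simp only: z lessThan_iff mult_zero_left)
    moreover have "(\<Sum>i<3 * 2 ^ m. ?\<psi> (real (3 * n * 2 ^ m + i) / 2 ^ m) *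
        (X (real (Suc (3 * n * 2 ^ m + i)) / 2 ^ m) \<omega> - X (real (3 * n * 2 ^ m + i) / 2 ^ m) \<omega>)) =
        dyadic_noise X m n \<omega>"
      unfolding dyadic_noise_def add_Suc_right[symmetric] sh by (intro sum.cong) simp_all
    ultimately show ?thesis
      unfolding add_mult_distrib sum_lessThan_add by linarith
  qed
  ultimately show ?thesis by (simp add: levy_white_noise_def)
qed


text \<open>
  The translates by \<open>3 * n\<close> have non-overlapping supports, so different \<open>n\<close> use different
  increments.
\<close>

lemma (in prob_space) indep_dyadic_noise:
  assumes L: "levy_process M X"
  shows "indep_vars (\<lambda>_. borel) (dyadic_noise X m) {..<K}"
proof -
  let ?D = "\<lambda>i \<omega>. X (real (0::nat) + real (Suc i) / 2 ^ m) \<omega> - X (real (0::nat) + real i / 2 ^ m) \<omega>"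
  let ?J = "\<lambda>n. {3 * n * 2 ^ m..<3 * Suc n * 2 ^ m}"
  have sub: "?J n \<subseteq> {..<3 * K * 2 ^ m}" if "n \<in> {..<K}" for n
  proof -
    have "3 * Suc n * 2 ^ m \<le> 3 * K * 2 ^ m" using that by (intro mult_le_mono) auto
    then show ?thesis unfolding subset_iff atLeastLessThan_iff lessThan_iff
      using less_le_trans by blast
  qed
  have disj: "disjoint_family_on ?J {..<K}"
  proof -
    have "?J n \<inter> ?J n' = {}" if "n < n'" for n n'
    proof -
      have "3 * Suc n * 2 ^ m \<le> 3 * n' * 2 ^ m" using that by (intro mult_le_mono) auto
      then show ?thesis by (simp only: ivl_disj_un disjoint_iff atLeastLessThan_iff) (meson leD less_le_trans)
    qed
    then show ?thesis unfolding disjoint_family_on_def by (metis Int_commute linorder_neqE_nat)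
  qed
  have "indep_vars (\<lambda>j. PiM (?J j) (\<lambda>_. borel)) (\<lambda>j \<omega>. restrict (\<lambda>i. ?D i \<omega>) (?J j)) {..<K}"
    by (rule indep_vars_restrict[OF levy_indep_increments[OF L] sub disj])
  then have "indep_vars (\<lambda>_. borel) (\<lambda>n \<omega>. (\<lambda>y. \<Sum>i<3 * 2 ^ m. plateau (real i / 2 ^ m) * y (3 * n * 2 ^ m + i))
      (restrict (\<lambda>i. ?D i \<omega>) (?J n))) {..<K}"
    by (rule indep_vars_compose2)
      (intro borel_measurable_sum borel_measurable_times borel_measurable_const measurable_component_singleton, auto simp: add_mult_distrib)
  moreover have "(\<Sum>i<3 * 2 ^ m. plateau (real i / 2 ^ m) * (restrict (\<lambda>i. ?D i \<omega>) (?J n)) (3 * n * 2 ^ m + i)) =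
      dyadic_noise X m n \<omega>" for n \<omega>
    unfolding dyadic_noise_def
  proof (intro sum.cong refl arg_cong2[where f="(*)"])
    fix i assume "i \<in> {..<3 * (2::nat) ^ m}"
    then have "3 * n * 2 ^ m + i \<in> ?J n" by (simp add: add_mult_distrib)
    moreover have "real (3 * n * 2 ^ m + i) / 2 ^ m = real (3 * n) + real i / 2 ^ m" for i
      by (simp add: field_simps)
    ultimately show "(restrict (\<lambda>i. ?D i \<omega>) (?J n)) (3 * n * 2 ^ m + i) =
        X (real (3 * n) + real (Suc i) / 2 ^ m) \<omega> - X (real (3 * n) + real i / 2 ^ m) \<omega>"
      by (simp only: restrict_apply' add_Suc_right[symmetric] of_nat_0 add_0)
  qed
  ultimately show ?thesis by simp
qed

text \<open>
  On its plateau the test function sees exactly the unit increment of \<open>X\<close>.  The two flanks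
  contribute an independent term, which summation by parts bounds by the oscillation of the
  path; by the maximal inequality it is tight uniformly in the mesh and in the position.
\<close>

lemma (in prob_space) dyadic_noise_tail:
  assumes L: "levy_process M X"
  shows "\<exists>c0\<ge>0. \<forall>c\<ge>c0. \<forall>m n. 1 / 2 * prob {\<omega> \<in> space M. \<bar>X 1 \<omega> - X 0 \<omega>\<bar> > 2 * c} \<le>
    prob {\<omega> \<in> space M. \<bar>dyadic_noise X m n \<omega>\<bar> > c}"
proof -
  obtain D where D: "D > 0" "\<And>x. \<bar>(deriv ^^ 1) plateau x\<bar> \<le> D"
    using funpow_deriv_plateau_bounded[of 1] by blast
  \<comment> \<open>an oscillation of at most \<open>a\<close> bounds the flanks by \<open>(3 * D + 2) * a\<close>; the extra factor \<open>2\<close>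
    is the one in the maximal inequality\<close>
  define E where "E = 2 * (3 * D + 2)"
  have E: "E > 0" using D by (simp add: E_def)
  obtain a0 where a0: "a0 \<ge> 0" "\<And>a n m. a \<ge> a0 \<Longrightarrow>
    prob {\<omega> \<in> space M. \<exists>k\<le>3 * 2 ^ m. \<bar>X (real n + real k / 2 ^ m) \<omega> - X (real n) \<omega>\<bar> > 2 * a} \<le>
    2 * prob {\<omega> \<in> space M. \<bar>X (real 3) \<omega> - X 0 \<omega>\<bar> > a}"
    using levy_maximal_inequality[OF L, of 3] by blast
  obtain a1 where a1: "\<And>a. a \<ge> a1 \<Longrightarrow> prob {\<omega> \<in> space M. \<bar>X (real 3) \<omega> - X 0 \<omega>\<bar> \<le> a} \<ge> 1 - 1 / 4"
  proof -
    have "\<exists>a1\<ge>0. \<forall>a\<ge>a1. \<forall>s\<in>{0..real 3}. prob {\<omega> \<in> space M. \<bar>X s \<omega> - X 0 \<omega>\<bar> \<le> a} \<ge> 1 - 1 / 4"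
      by (rule levy_tight[OF L]) simp
    moreover have "real 3 \<in> {0..real 3}" by simp
    ultimately show ?thesis using that by blast
  qed
  have [measurable]: "X (real 3) \<in> borel_measurable M" "X 0 \<in> borel_measurable M"
    by (rule levy_measurable[OF L], simp)+
  have main: "1 / 2 * prob {\<omega> \<in> space M. \<bar>X 1 \<omega> - X 0 \<omega>\<bar> > 2 * c} \<le>
      prob {\<omega> \<in> space M. \<bar>dyadic_noise X m n \<omega>\<bar> > c}" if c: "c \<ge> E * max a0 a1" for c m n
  proof -
    let ?x = "\<lambda>\<omega> i. X (real (3 * n) + real i / 2 ^ m) \<omega>"
    let ?w = "\<lambda>i. plateau (real i / 2 ^ m)"
    define J where "J = {2 ^ m..<2 * (2::nat) ^ m}"
    define K where "K = {..<3 * 2 ^ m} - J"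
    have [measurable]: "X (real n + real i / 2 ^ m) \<in> borel_measurable M" for n i
      by (rule levy_dyadic_measurable[OF L])
    define mid where "mid \<omega> = (\<Sum>i\<in>J. ?x \<omega> (Suc i) - ?x \<omega> i)" for \<omega>
    define flank where "flank \<omega> = (\<Sum>i\<in>K. ?w i * (?x \<omega> (Suc i) - ?x \<omega> i))" for \<omega>
    have [measurable]: "mid \<in> borel_measurable M" "flank \<in> borel_measurable M"
      "dyadic_noise X m n \<in> borel_measurable M"
      unfolding mid_def[abs_def] flank_def[abs_def] dyadic_noise_def[abs_def] by measurable
    have split: "dyadic_noise X m n \<omega> = mid \<omega> + flank \<omega>" for \<omega>
    proof -
      have "?w i = 1" if "i \<in> J" for i
      proof (rule plateau_eq_1)
        have i: "2 ^ m \<le> i" "i \<le> 2 * 2 ^ m" using that by (auto simp: J_def)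
        have "real (2 ^ m) \<le> real i" "real i \<le> real (2 * 2 ^ m)"
          using i by (simp_all only: of_nat_le_iff)
        then show "1 \<le> real i / 2 ^ m" "real i / 2 ^ m \<le> 2"
          by (simp_all add: le_divide_eq divide_le_eq)
      qed
      then have "mid \<omega> = (\<Sum>i\<in>J. ?w i * (?x \<omega> (Suc i) - ?x \<omega> i))"
        unfolding mid_def by (intro sum.cong) auto
      moreover have "dyadic_noise X m n \<omega> = (\<Sum>i\<in>K. ?w i * (?x \<omega> (Suc i) - ?x \<omega> i)) +
          (\<Sum>i\<in>J. ?w i * (?x \<omega> (Suc i) - ?x \<omega> i))"
        unfolding dyadic_noise_def K_def by (rule sum.subset_diff) (auto simp: J_def)
      ultimately show ?thesis by (simp add: flank_def)
    qed
    have mid: "mid \<omega> = X (real (3 * n) + 1 + 1) \<omega> - X (real (3 * n) + 1) \<omega>" for \<omega>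
    proof -
      have "mid \<omega> = ?x \<omega> (2 * 2 ^ m) - ?x \<omega> (2 ^ m)"
        unfolding mid_def J_def by (rule sum_Suc_diff') simp
      then show ?thesis by (simp add: add.assoc)
    qed
    have flank_le: "\<bar>flank \<omega>\<bar> \<le> (3 * D + 2) * a"
      if "\<And>k. k \<le> 3 * 2 ^ m \<Longrightarrow> \<bar>?x \<omega> k - X (real (3 * n)) \<omega>\<bar> \<le> a" for \<omega> a
    proof -
      have "\<bar>dyadic_noise X m n \<omega>\<bar> \<le> real (3 * 2 ^ m) * (a * (D / 2 ^ m))"
        unfolding dyadic_noise_def
      proof (rule weighted_increments_le)
        show "?w 0 = 0" "?w (3 * 2 ^ m) = 0" by (simp_all add: plateau_eq_0)
        show "\<bar>?w (Suc i) - ?w i\<bar> \<le> D / 2 ^ m" for i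
        proof -
          have "norm (?w (Suc i) - ?w i) \<le> D * norm (real (Suc i) / 2 ^ m - real i / 2 ^ m)"
            by (rule field_differentiable_bound[of UNIV plateau "deriv plateau"])
              (use D(2) in \<open>auto intro: smooth_DERIV smooth_plateau\<close>)
          then show ?thesis by (simp add: diff_divide_distrib[symmetric])
        qed
        show "\<bar>?x \<omega> k - ?x \<omega> 0\<bar> \<le> a" if "k \<le> 3 * 2 ^ m" for k
          using \<open>\<And>k. k \<le> 3 * 2 ^ m \<Longrightarrow> \<bar>?x \<omega> k - X (real (3 * n)) \<omega>\<bar> \<le> a\<close>[OF that] by simp
      qed
      moreover have "\<bar>mid \<omega>\<bar> \<le> 2 * a"
      proof -
        have "\<bar>?x \<omega> (2 * 2 ^ m) - X (real (3 * n)) \<omega>\<bar> \<le> a" "\<bar>?x \<omega> (2 ^ m) - X (real (3 * n)) \<omega>\<bar> \<le> a"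
          by (rule that, simp)+
        then show ?thesis unfolding mid by (simp add: add.assoc)
      qed
      moreover have "real (3 * 2 ^ m) * (a * (D / 2 ^ m)) = 3 * D * a" by simp
      moreover have "(3 * D + 2) * a = 3 * D * a + 2 * a" by (simp add: distrib_right)
      ultimately show ?thesis using split[of \<omega>] by linarith
    qed
    have half: "1 / 2 \<le> prob {\<omega> \<in> space M. \<bar>flank \<omega>\<bar> \<le> c}"
    proof -
      let ?G = "{\<omega> \<in> space M. \<exists>k\<le>3 * 2 ^ m. \<bar>?x \<omega> k - X (real (3 * n)) \<omega>\<bar> > 2 * (c / E)}"
      have cE: "c / E \<ge> max a0 a1" using c E by (simp add: le_divide_eq mult.commute)
      have G: "?G \<in> events"
      proof -
        have [measurable]: "X (real (3 * n)) \<in> borel_measurable M"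
          by (rule levy_dyadic_measurable[OF L])
        have "?G = (\<Union>k\<in>{..3 * 2 ^ m}. {\<omega> \<in> space M. \<bar>?x \<omega> k - X (real (3 * n)) \<omega>\<bar> > 2 * (c / E)})"
          by auto
        also have "\<dots> \<in> events" by (rule sets.finite_UN) measurable
        finally show ?thesis .
      qed
      have "prob ?G \<le> 2 * prob {\<omega> \<in> space M. \<bar>X (real 3) \<omega> - X 0 \<omega>\<bar> > c / E}"
        using cE by (intro a0(2)) simp
      also have "{\<omega> \<in> space M. \<bar>X (real 3) \<omega> - X 0 \<omega>\<bar> > c / E} =
          space M - {\<omega> \<in> space M. \<bar>X (real 3) \<omega> - X 0 \<omega>\<bar> \<le> c / E}" by auto
      also have "prob \<dots> = 1 - prob {\<omega> \<in> space M. \<bar>X (real 3) \<omega> - X 0 \<omega>\<bar> \<le> c / E}"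
        by (rule prob_compl) measurable
      finally have "prob ?G \<le> 1 / 2" using a1[of "c / E"] cE by simp
      then have "1 / 2 \<le> prob (space M - ?G)" using prob_compl[OF G] by simp
      also have "\<dots> \<le> prob {\<omega> \<in> space M. \<bar>flank \<omega>\<bar> \<le> c}"
      proof (rule finite_measure_mono)
        show "space M - ?G \<subseteq> {\<omega> \<in> space M. \<bar>flank \<omega>\<bar> \<le> c}"
        proof (rule subsetI)
          fix \<omega> assume "\<omega> \<in> space M - ?G"
          then have \<omega>: "\<omega> \<in> space M" "\<omega> \<notin> ?G" by blast+
          have "\<bar>flank \<omega>\<bar> \<le> (3 * D + 2) * (2 * (c / E))"
          proof (rule flank_le)
            fix k :: nat assume "k \<le> 3 * 2 ^ m"
            then show "\<bar>?x \<omega> k - X (real (3 * n)) \<omega>\<bar> \<le> 2 * (c / E)"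
              using \<omega> by (simp add: not_less[symmetric]) blast
          qed
          also have "\<dots> = E * (c / E)" unfolding E_def by (simp only: mult_ac)
          also have "\<dots> = c" using E by simp
          finally show "\<omega> \<in> {\<omega> \<in> space M. \<bar>flank \<omega>\<bar> \<le> c}" using \<omega>(1) by blast
        qed
      qed measurable
      finally show ?thesis .
    qed
    let ?P = "\<lambda>y::nat \<Rightarrow> real. 2 * c < \<bar>\<Sum>i\<in>J. y i\<bar>" and ?Q = "\<lambda>y::nat \<Rightarrow> real. \<bar>\<Sum>i\<in>K. ?w i * y i\<bar> \<le> c"
    let ?d = "\<lambda>\<omega> i. ?x \<omega> (Suc i) - ?x \<omega> i"
    have "prob {\<omega> \<in> space M. ?P (?d \<omega>) \<and> ?Q (?d \<omega>)} =
        prob {\<omega> \<in> space M. ?P (?d \<omega>)} * prob {\<omega> \<in> space M. ?Q (?d \<omega>)}"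
    proof (rule indep_vars_prob_conj[OF levy_indep_increments[OF L, of "3 * n" m "3 * 2 ^ m"], of J K])
      have "(\<lambda>y. \<Sum>i\<in>J. y i) \<in> borel_measurable (PiM J (\<lambda>_. borel :: real measure))"
        by (intro borel_measurable_sum measurable_component_singleton)
      then show "{y \<in> space (PiM J (\<lambda>_. borel)). ?P y} \<in> sets (PiM J (\<lambda>_. borel))"
        by (intro borel_measurable_less) auto
      have "(\<lambda>y. \<Sum>i\<in>K. ?w i * y i) \<in> borel_measurable (PiM K (\<lambda>_. borel :: real measure))"
        by (intro borel_measurable_sum borel_measurable_times borel_measurable_const measurable_component_singleton)
      then show "{y \<in> space (PiM K (\<lambda>_. borel)). ?Q y} \<in> sets (PiM K (\<lambda>_. borel))"
        by (intro borel_measurable_le) auto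
    qed (auto simp: K_def J_def)
    then have "prob {\<omega> \<in> space M. 2 * c < \<bar>mid \<omega>\<bar> \<and> \<bar>flank \<omega>\<bar> \<le> c} =
        prob {\<omega> \<in> space M. 2 * c < \<bar>mid \<omega>\<bar>} * prob {\<omega> \<in> space M. \<bar>flank \<omega>\<bar> \<le> c}"
      unfolding mid_def flank_def .
    moreover have "prob {\<omega> \<in> space M. 2 * c < \<bar>mid \<omega>\<bar>} = prob {\<omega> \<in> space M. \<bar>X 1 \<omega> - X 0 \<omega>\<bar> > 2 * c}"
      unfolding mid by (rule levy_stationary_increments[OF L]) auto
    moreover have "prob {\<omega> \<in> space M. 2 * c < \<bar>mid \<omega>\<bar> \<and> \<bar>flank \<omega>\<bar> \<le> c} \<le>
        prob {\<omega> \<in> space M. \<bar>dyadic_noise X m n \<omega>\<bar> > c}"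
      by (rule finite_measure_mono) (auto simp: split)
    moreover have "1 / 2 * prob {\<omega> \<in> space M. \<bar>X 1 \<omega> - X 0 \<omega>\<bar> > 2 * c} \<le>
        prob {\<omega> \<in> space M. \<bar>flank \<omega>\<bar> \<le> c} * prob {\<omega> \<in> space M. \<bar>X 1 \<omega> - X 0 \<omega>\<bar> > 2 * c}"
      by (rule mult_right_mono[OF half]) simp
    ultimately show ?thesis by (simp add: mult.commute)
  qed
  show ?thesis
  proof (intro exI[of _ "E * max a0 a1"] conjI allI impI)
    show "0 \<le> E * max a0 a1" using E a0(1) by simp
  qed (rule main)
qed


text \<open>
  The second Borel--Cantelli argument, run on the dyadic sums, whose independence is known.
  Strict bounds on the first \<open>K\<close> limits pass to all sufficiently fine dyadic sums.  If \<open>p n\<close>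
  is the probability of \<open>\<bar>X 1 - X 0\<bar> > 2 * c n\<close>, the probability that the first \<open>K\<close> dyadic
  sums of one mesh obey the bounds is a product of factors at most \<open>1 - p n / 2\<close>, hence at
  most \<open>exp (- (\<Sum>n<K. p n) / 2)\<close>, which tends to \<open>0\<close>.
\<close>

lemma (in prob_space) white_noise_bounds_null:
  fixes c :: "nat \<Rightarrow> real"
  assumes L: "levy_process M X"
    and tail: "\<And>m n. 1 / 2 * prob {\<omega> \<in> space M. \<bar>X 1 \<omega> - X 0 \<omega>\<bar> > 2 * c n} \<le>
      prob {\<omega> \<in> space M. \<bar>dyadic_noise X m n \<omega>\<bar> > c n}"
    and div: "\<not> summable (\<lambda>n. prob {\<omega> \<in> space M. \<bar>X 1 \<omega> - X 0 \<omega>\<bar> > 2 * c n})"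
  shows "\<exists>H\<in>null_sets M. {\<omega> \<in> space M. \<forall>n. \<bar>levy_white_noise X \<omega> (\<lambda>x. plateau (x - 3 * real n))\<bar> < c n} \<subseteq> H"
proof -
  define p where "p n = prob {\<omega> \<in> space M. \<bar>X 1 \<omega> - X 0 \<omega>\<bar> > 2 * c n}" for n
  have [measurable]: "dyadic_noise X m n \<in> borel_measurable M" for m n
    using indep_dyadic_noise[OF L, of m "Suc n"] by (auto simp: indep_vars_def)
  define A where "A K m = {\<omega> \<in> space M. \<forall>n\<in>{..<K}. \<bar>dyadic_noise X m n \<omega>\<bar> \<le> c n}" for K m
  define G where "G K j = (\<Inter>m\<in>{j..}. A K m)" for K j
  define H where "H = (\<Inter>K. \<Union>j. G K j)"
  have A: "A K m \<in> events" for K m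
    unfolding A_def by measurable
  have G: "G K j \<in> events" for K j
    unfolding G_def using A by (intro sets.countable_INT') auto
  have H: "H \<in> events" 
  proof -
    have "(\<Union>j. G K j) \<in> events" for K using G by blast
    then show ?thesis unfolding H_def by (intro sets.countable_INT') auto
  qed
  have A_le: "prob (A K m) \<le> exp (- (1 / 2) * (\<Sum>n<K. p n))" for K m
  proof (cases "K = 0")
    case False
    let ?B = "\<lambda>n. dyadic_noise X m n -` {- c n..c n} \<inter> space M"
    have "A K m = (\<Inter>n\<in>{..<K}. ?B n)"
    proof -
      have "\<bar>z\<bar> \<le> b \<longleftrightarrow> z \<in> {- b..b}" for z b :: real by auto
      then show ?thesis using False unfolding A_def by auto
    qed
    then have "prob (A K m) = prob (\<Inter>n\<in>{..<K}. ?B n)" by simp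
    also have "\<dots> = (\<Prod>n<K. prob (?B n))"
      using False by (intro indep_varsD_finite[OF indep_dyadic_noise[OF L]]) auto
    also have "\<dots> \<le> (\<Prod>n<K. exp (- (1 / 2) * p n))"
    proof (intro prod_mono conjI)
      fix n
      have "?B n = space M - {\<omega> \<in> space M. \<bar>dyadic_noise X m n \<omega>\<bar> > c n}" by auto
      then have "prob (?B n) = 1 - prob {\<omega> \<in> space M. \<bar>dyadic_noise X m n \<omega>\<bar> > c n}"
        by (simp add: prob_compl)
      also have "\<dots> \<le> 1 + (- (1 / 2) * p n)" using tail[of n m] by (simp add: p_def)
      also have "\<dots> \<le> exp (- (1 / 2) * p n)" by (rule exp_ge_add_one_self)
      finally show "prob (?B n) \<le> exp (- (1 / 2) * p n)" .
    qed simp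
    also have "\<dots> = exp (- (1 / 2) * (\<Sum>n<K. p n))"
      by (simp add: exp_sum sum_distrib_left del: mult_minus_left)
    finally show ?thesis .
  qed simp
  have H_le: "prob H \<le> exp (- (1 / 2) * (\<Sum>n<K. p n))" for K
  proof -
    have "prob H \<le> prob (\<Union>j. G K j)"
      unfolding H_def using G by (intro finite_measure_mono) auto
    also have "\<dots> \<le> exp (- (1 / 2) * (\<Sum>n<K. p n))"
    proof (rule LIMSEQ_le_const2)
      show "(\<lambda>j. prob (G K j)) \<longlonglongrightarrow> prob (\<Union>j. G K j)"
        using G by (intro finite_Lim_measure_incseq) (auto simp: incseq_def G_def)
      have le: "prob (G K j) \<le> prob (A K j)" for j
        unfolding G_def using A by (intro finite_measure_mono) auto
      show "\<exists>N. \<forall>j\<ge>N. prob (G K j) \<le> exp (- (1 / 2) * (\<Sum>n<K. p n))"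
        by (intro exI allI impI order_trans[OF le A_le])
    qed
    finally show ?thesis .
  qed
  have "prob H = 0"
  proof (rule ccontr)
    assume "prob H \<noteq> 0"
    then have pos: "prob H > 0" by (simp add: zero_less_measure_iff)
    have "(\<Sum>n<K. p n) \<le> - 2 * ln (prob H)" for K
    proof -
      have "ln (prob H) \<le> - (1 / 2) * (\<Sum>n<K. p n)"
        using H_le[of K] pos by (metis exp_le_cancel_iff exp_ln)
      then show ?thesis by simp
    qed
    then have "summable p"
      by (intro summableI_nonneg_bounded[of p "- 2 * ln (prob H)"]) (auto simp: p_def)
    then show False using div by (simp add: p_def[abs_def])
  qed
  then have "H \<in> null_sets M" using H by (simp add: null_sets_def emeasure_eq_measure)
  moreover have "{\<omega> \<in> space M. \<forall>n. \<bar>levy_white_noise X \<omega> (\<lambda>x. plateau (x - 3 * real n))\<bar> < c n} \<subseteq> H"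
  proof safe
    fix \<omega> assume \<omega>: "\<omega> \<in> space M"
      and lt: "\<forall>n. \<bar>levy_white_noise X \<omega> (\<lambda>x. plateau (x - 3 * real n))\<bar> < c n"
    have "\<omega> \<in> (\<Union>j. G K j)" for K
    proof -
      have "eventually (\<lambda>m. \<bar>dyadic_noise X m n \<omega>\<bar> < c n) sequentially" for n
        using tendsto_rabs[OF dyadic_noise_tendsto[OF L \<omega>]] lt by (intro order_tendstoD) auto
      then have "eventually (\<lambda>m. \<forall>n\<in>{..<K}. \<bar>dyadic_noise X m n \<omega>\<bar> < c n) sequentially"
        by (intro eventually_ball_finite) auto
      then obtain j where "\<And>m. m \<ge> j \<Longrightarrow> \<forall>n\<in>{..<K}. \<bar>dyadic_noise X m n \<omega>\<bar> < c n"
        unfolding eventually_sequentially by blast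
      then have "\<omega> \<in> G K j" using \<omega> by (force simp: G_def A_def)
      then show ?thesis by blast
    qed
    then show "\<omega> \<in> H" by (simp add: H_def)
  qed
  ultimately show ?thesis by blast
qed

section \<open>Tempered white noise and moments\<close>

lemma (in prob_space) tempered_AE_if_moment:
  assumes L: "levy_process M X" and \<eta>: "\<eta> > 0"
    and fin: "(\<integral>\<^sup>+\<omega>. ennreal (\<bar>X 1 \<omega> - X 0 \<omega>\<bar> powr \<eta>) \<partial>M) < \<infinity>"
  shows "AE \<omega> in M. \<omega> \<in> tempered_event M X"
proof -
  have "(\<lambda>\<omega>. X 1 \<omega> - X 0 \<omega>) \<in> borel_measurable M"
    by (intro borel_measurable_diff levy_measurable[OF L]) auto
  from summable_tail_if_moment[OF this \<eta> fin] obtain p where p: "p \<ge> 1"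
    "summable (\<lambda>n. prob {\<omega> \<in> space M. \<bar>X 1 \<omega> - X 0 \<omega>\<bar> > (real n + 1) ^ p})" by blast
  show ?thesis
    using levy_poly_growth_AE[OF L p] AE_space
  proof eventually_elim
    case (elim \<omega>)
    then obtain C where "\<And>t. t \<ge> 0 \<Longrightarrow> \<bar>X t \<omega>\<bar> \<le> C * (1 + t) ^ Suc p" by blast
    then have "tempered_distribution (levy_white_noise X \<omega>)"
      unfolding levy_white_noise_def[abs_def]
      by (rule white_noise_tempered_if_poly_growth[OF levy_cadlag[OF L elim(2)]])
    then show ?case using elim(2) by (auto simp: tempered_event_def extends_to_tempered_def)
  qed
qed

lemma (in prob_space) tempered_null_if_no_moment:
  assumes L: "levy_process M X"
    and inf: "\<And>\<eta>. \<eta> > 0 \<Longrightarrow> (\<integral>\<^sup>+\<omega>. ennreal (\<bar>X 1 \<omega> - X 0 \<omega>\<bar> powr \<eta>) \<partial>M) = \<infinity>"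
  shows "\<exists>H\<in>null_sets M. tempered_event M X \<subseteq> H"
proof -
  let ?Z = "\<lambda>\<omega> n. levy_white_noise X \<omega> (\<lambda>x. plateau (x - 3 * real n))"
  obtain c0 where c0: "c0 \<ge> 0" "\<And>c m n. c \<ge> c0 \<Longrightarrow>
      1 / 2 * prob {\<omega> \<in> space M. \<bar>X 1 \<omega> - X 0 \<omega>\<bar> > 2 * c} \<le>
      prob {\<omega> \<in> space M. \<bar>dyadic_noise X m n \<omega>\<bar> > c}"
    using dyadic_noise_tail[OF L] by blast
  have meas: "(\<lambda>\<omega>. X 1 \<omega> - X 0 \<omega>) \<in> borel_measurable M"
    by (intro borel_measurable_diff levy_measurable[OF L]) auto
  \<comment> \<open>strictly above \<open>N * (n + 1) ^ N\<close>, at least \<open>c0\<close>, and a constant times a positive power of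
    \<open>n + 1\<close> even for \<open>N = 0\<close>\<close>
  define c where "c N n = (real N + 1 + c0) * (real n + 1) ^ Suc N" for N n :: nat
  have "\<exists>H\<in>null_sets M. {\<omega> \<in> space M. \<forall>n. \<bar>?Z \<omega> n\<bar> < c N n} \<subseteq> H" for N
  proof (rule white_noise_bounds_null[OF L])
    have "c N n \<ge> c0" for n
    proof -
      have "c0 * 1 \<le> (real N + 1 + c0) * (real n + 1) ^ Suc N"
        using c0(1) by (intro mult_mono one_le_power) simp_all
      then show ?thesis by (simp add: c_def)
    qed
    then show "1 / 2 * prob {\<omega> \<in> space M. \<bar>X 1 \<omega> - X 0 \<omega>\<bar> > 2 * c N n} \<le>
        prob {\<omega> \<in> space M. \<bar>dyadic_noise X m n \<omega>\<bar> > c N n}" for m n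
      by (rule c0(2))
    show "\<not> summable (\<lambda>n. prob {\<omega> \<in> space M. \<bar>X 1 \<omega> - X 0 \<omega>\<bar> > 2 * c N n})"
    proof
      assume "summable (\<lambda>n. prob {\<omega> \<in> space M. \<bar>X 1 \<omega> - X 0 \<omega>\<bar> > 2 * c N n})"
      then have "summable (\<lambda>n. prob {\<omega> \<in> space M. \<bar>X 1 \<omega> - X 0 \<omega>\<bar> >
          (2 * (real N + 1 + c0)) * (real n + 1) ^ Suc N})"
        unfolding c_def by (simp only: mult.assoc)
      from moment_if_summable_tail[OF meas _ _ this]
      have "(\<integral>\<^sup>+\<omega>. ennreal (\<bar>X 1 \<omega> - X 0 \<omega>\<bar> powr (1 / real (Suc N))) \<partial>M) < \<infinity>"
        using c0(1) by simp
      then show False using inf[of "1 / real (Suc N)"] by simp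
    qed
  qed
  then have "\<forall>N. \<exists>H. H \<in> null_sets M \<and> {\<omega> \<in> space M. \<forall>n. \<bar>?Z \<omega> n\<bar> < c N n} \<subseteq> H" by blast
  from choice[OF this] obtain H where H: "\<And>N. H N \<in> null_sets M"
    "\<And>N. {\<omega> \<in> space M. \<forall>n. \<bar>?Z \<omega> n\<bar> < c N n} \<subseteq> H N" by blast
  have "(\<Union>N. H N) \<in> null_sets M" using H(1) by (rule null_sets_UN)
  moreover have "tempered_event M X \<subseteq> (\<Union>N. H N)"
  proof
    fix \<omega> assume "\<omega> \<in> tempered_event M X"
    then obtain T where T: "\<omega> \<in> space M" "tempered_distribution T"
      "\<And>\<phi>. \<phi> \<in> test_functions \<Longrightarrow> T \<phi> = levy_white_noise X \<omega> \<phi>"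
      by (auto simp: tempered_event_def extends_to_tempered_def)
    from tempered_plateau_translates_poly_bound[OF T(2)] obtain N
      where N: "\<And>n. \<bar>T (\<lambda>x. plateau (x - 3 * real n))\<bar> \<le> real N * (real n + 1) ^ N" by blast
    have "\<bar>?Z \<omega> n\<bar> < c N n" for n
    proof -
      have "\<bar>?Z \<omega> n\<bar> \<le> real N * (real n + 1) ^ N"
        using N[of n] by (simp add: T(3) plateau_translate_test_function)
      also have "\<dots> \<le> real N * (real n + 1) ^ Suc N"
        by (intro mult_left_mono power_increasing) auto
      also have "\<dots> < c N n"
        unfolding c_def using c0(1) by (intro mult_strict_right_mono) auto
      finally show ?thesis .
    qed
    then have "\<omega> \<in> H N" using H(2)[of N] T(1) by blast
    then show "\<omega> \<in> (\<Union>N. H N)" by blast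
  qed
  ultimately show ?thesis by blast
qed

theorem theorem2p10:
  fixes M :: "'a measure" and X :: "real \<Rightarrow> 'a \<Rightarrow> real"
    and \<gamma> \<sigma> :: real and \<nu> :: "real measure"
  assumes "prob_space M" and "complete_measure M"
    and "levy_process M X"
    and "characteristic_triplet M X \<gamma> \<sigma> \<nu>"
  shows
    "((\<exists>\<eta>>0. (\<integral>\<^sup>+\<omega>. ennreal (\<bar>X 1 \<omega>\<bar> powr \<eta>) \<partial>M) < \<infinity>) \<longrightarrow>
        tempered_event M X \<in> sets M \<and> measure M (tempered_event M X) = 1) \<and>
     ((\<forall>\<eta>>0. (\<integral>\<^sup>+\<omega>. ennreal (\<bar>X 1 \<omega>\<bar> powr \<eta>) \<partial>M) = \<infinity>) \<longrightarrow>
        tempered_event M X \<in> sets M \<and> measure M (tempered_event M X) = 0)"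
proof -
  interpret prob_space M by fact
  interpret complete_measure M by fact
  note L = \<open>levy_process M X\<close>
  \<comment> \<open>increments are what the lemmas speak of, and \<open>X 0\<close> vanishes only almost surely\<close>
  have "AE \<omega> in M. X 0 \<omega> = 0" using L by (simp add: levy_process_def)
  then have X1: "(\<integral>\<^sup>+\<omega>. ennreal (\<bar>X 1 \<omega>\<bar> powr \<eta>) \<partial>M) = (\<integral>\<^sup>+\<omega>. ennreal (\<bar>X 1 \<omega> - X 0 \<omega>\<bar> powr \<eta>) \<partial>M)" for \<eta>
    by (intro nn_integral_cong_AE) auto
  have sub: "tempered_event M X \<subseteq> space M" by (auto simp: tempered_event_def)
  show ?thesis
  proof (intro conjI[of "_ \<longrightarrow> _"] impI)
    assume "\<exists>\<eta>>0. (\<integral>\<^sup>+\<omega>. ennreal (\<bar>X 1 \<omega>\<bar> powr \<eta>) \<partial>M) < \<infinity>"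
    then have AE: "AE \<omega> in M. \<omega> \<in> tempered_event M X"
      unfolding X1 using tempered_AE_if_moment[OF L] by blast
    then obtain N where "N \<in> null_sets M" "space M - tempered_event M X \<subseteq> N"
      by (auto simp: eventually_ae_filter set_diff_eq)
    then have "space M - tempered_event M X \<in> events" using complete2 by blast
    then have "space M - (space M - tempered_event M X) \<in> events" by blast
    then have "tempered_event M X \<in> events" using sub by (simp add: double_diff)
    then show "tempered_event M X \<in> events \<and> prob (tempered_event M X) = 1"
      using AE prob_eq_1 by blast
  next
    assume "\<forall>\<eta>>0. (\<integral>\<^sup>+\<omega>. ennreal (\<bar>X 1 \<omega>\<bar> powr \<eta>) \<partial>M) = \<infinity>"
    then obtain H where H: "H \<in> null_sets M" "tempered_event M X \<subseteq> H"
      unfolding X1 using tempered_null_if_no_moment[OF L] by blast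
    then have T: "tempered_event M X \<in> events" using complete2 by blast
    then have "tempered_event M X \<in> null_sets M" using H null_sets_subset by blast
    then show "tempered_event M X \<in> events \<and> prob (tempered_event M X) = 0"
      using T by (simp add: null_sets_def measure_def)
  qed
qed

end
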